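(* Let $\mathcal{M}=\{(M_i,\varphi_i)\}_{i=1}^n$ be a persistence module over a field $\mathbb{F}$, given by matrices of its structure maps with respect to fixed bases. Then the set $\mathscr{V}$ returned by the persistence module decomposition algorithm (described in the context) on input $\mathcal{M}$ is an interval basis for $\mathcal{M}$.
   Context: A persistence module $\mathcal{M}=\{(M_i,\varphi_i)\}_{i=1}^n$ over a field $\mathbb{F}$ consists of finite-dimensional $\mathbb{F}$-vector spaces $M_1,\dots,M_n$ and linear maps $\varphi_i:M_i\to M_{i+1}$, $1\le i\le n-1$. Conventions: $M_0=M_{n+1}=0$, and $\varphi_0:M_0\to M_1$, $\varphi_n:M_n\to M_{n+1}$ are null maps. For $i<j$, $\varphi_{i,j}=\varphi_{j-1}\circ\cdots\circ\varphi_i$, and $\varphi_{i,i}=\mathrm{id}$. For $v\in M_b$, $I(v)$ is the submodule of $\mathcal{M}$ with steps $I_i(v)=\langle\varphi_{b,i}(v)\rangle$ for $i\ge b$ and $I_i(v)=0$ for $i<b$, with structure maps the restrictions of the $\varphi_i$. A finite family $\{v_1,\dots,v_N\}$ of non-zero homogeneous elements (each in some $M_b$) is an interval basis for $\mathcal{M}$ if $\bigoplus_{m=1}^N I(v_m)=\mathcal{M}$, i.e. for every $i$ the space $M_i$ is the internal direct sum of the $I_i(v_m)$. Elements of different $M_b$ are regarded as distinct. Subroutine bca$(\mathcal{U},\mathcal{W})$ (basis completion): given a linearly independent list $\mathcal{U}$ and a linearly independent ordered list $\mathcal{W}=\{w_1,\dots,w_p\}$ in the same space, start with $\mathcal{R}=\emptyset$;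 for $a=1,\dots,p$, if $\operatorname{rank}(\mathcal{U})<\operatorname{rank}(\mathcal{U}\cup\{w_a\})$, add $w_a$ to both $\mathcal{U}$ and $\mathcal{R}$. Return $\mathcal{R}$. Subroutine ColumnReduction$(R,C,I)$: given an $a\times b$ matrix $R$, a $b\times b$ matrix $C$ and a set $I\subseteq\{1,\dots,b\}$ of indices of zero columns of $R$, start with $I'=\emptyset$; for $t=1,\dots,b$ with $t\notin I$, perform on the $t$-th column of $R$ the standard left-to-right reduction using the (already reduced) columns with indices in $\{1,\dots,t-1\}\setminus(I\cup I')$ (i.e. as long as the $t$-th column is non-zero and the index of its lowest non-zero entry equals that of one of these columns, subtract from it the multiple of that column cancelling this entry), performing the same column operations on $C$; if the $t$-th column of $R$ becomes zero, add $t$ to $I'$. Return the modified $R$, $C$, and $I'$. Single step decomposition ssd for step $i$: compute a basis $\mathcal{U}$ of $\operatorname{im}(\varphi_{i-1})$ and let $k=\dim\operatorname{im}(\varphi_{i-1})$. Initialize $R$ and $C$ to the identity matrix of $M_i$, $r=\dim M_i$, $\mathcal{V}^i_{\mathrm{Birth}}=\emptyset$, $\mathrm{inds}=\emptyset$. For $s=0,\dots,n-i$: replace $R$ by $\varphi_{i+s}\cdot R$; set $(R,C,\mathrm{newInds})=$ ColumnReduction$(R,C,\mathrm{inds})$; set $r'=r-|\mathrm{newInds}|$; if $r'<r$, let $B=\{Ce_t : t\in\mathrm{newInds}\}$, $B_{\mathrm{new}}=$ bca$(\mathcal{U},B)$, replace $\mathcal{U}$ by $\mathcal{U}\cup B_{\mathrm{new}}$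 and $\mathcal{V}^i_{\mathrm{Birth}}$ by $\mathcal{V}^i_{\mathrm{Birth}}\cup B_{\mathrm{new}}$, set $J(v)=s+1$ for $v\in B_{\mathrm{new}}$, set $r=r'$ and replace $\mathrm{inds}$ by $\mathrm{inds}\cup\mathrm{newInds}$. If $r=0$ or $|\mathcal{V}^i_{\mathrm{Birth}}|+k=\dim M_i$, stop the loop. Return $\mathcal{V}^i_{\mathrm{Birth}}$ and $J$. Persistence module decomposition algorithm: for each $i=1,\dots,n$ (independently, in parallel) run ssd for step $i$ to obtain $\mathcal{V}^i_{\mathrm{Birth}}$; return $\mathscr{V}=\bigcup_i\mathcal{V}^i_{\mathrm{Birth}}$ (together with the collection of pairs $(i,i+J(v))$ for $v\in\mathcal{V}^i_{\mathrm{Birth}}$). *)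

theory Defs
  imports
    "Jordan_Normal_Form.DL_Rank"
    "Jordan_Normal_Form.Column_Operations"
    "HOL-Library.While_Combinator"
    "HOL-Library.FuncSet"
begin

section \<open>Linear algebra\<close>

definition is_basis_list ::
  "('a::field, 'b, 'm) module_scheme \<Rightarrow> 'b set \<Rightarrow> 'b list \<Rightarrow> bool" where
  "is_basis_list V X xs \<longleftrightarrow>
     distinct xs \<and> set xs \<subseteq> carrier V \<and>
     \<not> module.lin_dep class_ring V (set xs) \<and>
     LinearCombinations.module.span class_ring V (set xs) = X"

definition internal_direct_sum ::
  "('a::field, 'b, 'm) module_scheme \<Rightarrow> 'p set \<Rightarrow> ('p \<Rightarrow> 'b set) \<Rightarrow> bool" where
  "internal_direct_sum V P W \<longleftrightarrow>
     (\<forall>p\<in>P. VectorSpace.subspace class_ring (W p) V) \<and>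
     (\<forall>x\<in>carrier V. \<exists>!f. f \<in> (\<Pi>\<^sub>E p\<in>P. W p) \<and> finsum V f P = x)"

section \<open>Persistence modules and interval bases\<close>

text \<open>The spaces are \<open>M 0, \<dots>, M (n + 1)\<close>, where \<open>M 0\<close> and \<open>M (n + 1)\<close> are the zero spaces of the
  usual convention; so \<open>\<phi> 0\<close> and \<open>\<phi> n\<close> are automatically null maps.\<close>

definition persistence_module ::
  "nat \<Rightarrow> (nat \<Rightarrow> ('a::field, 'b, 'm) module_scheme) \<Rightarrow> (nat \<Rightarrow> 'b \<Rightarrow> 'b) \<Rightarrow> bool" where
  "persistence_module n M \<phi> \<longleftrightarrow>
     (\<forall>i\<le>n + 1. vectorspace class_ring (M i) \<and> vectorspace.fin_dim class_ring (M i)) \<and>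
     (\<forall>i\<le>n. linear_map class_ring (M i) (M (i + 1)) (\<phi> i)) \<and>
     carrier (M 0) = {\<zero>\<^bsub>M 0\<^esub>} \<and> carrier (M (n + 1)) = {\<zero>\<^bsub>M (n + 1)\<^esub>}"

text \<open>The composite \<open>\<phi> (j - 1) \<circ> \<dots> \<circ> \<phi> i\<close>, which is the identity for \<open>j = i\<close>.\<close>

definition structure_map :: "(nat \<Rightarrow> 'b \<Rightarrow> 'b) \<Rightarrow> nat \<Rightarrow> nat \<Rightarrow> 'b \<Rightarrow> 'b" where
  "structure_map \<phi> i j = fold \<phi> [i..<j]"

text \<open>A homogeneous element is a pair \<open>(b, v)\<close> with \<open>v\<close> in \<open>M b\<close>, so that elements of different
  spaces are distinct even if the carriers overlap.\<close>

definition interval_step ::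
  "(nat \<Rightarrow> ('a::field, 'b, 'm) module_scheme) \<Rightarrow> (nat \<Rightarrow> 'b \<Rightarrow> 'b) \<Rightarrow> nat \<Rightarrow> nat \<times> 'b \<Rightarrow> 'b set" where
  "interval_step M \<phi> i = (\<lambda>(b, v).
     if i < b then {\<zero>\<^bsub>M i\<^esub>}
     else LinearCombinations.module.span class_ring (M i) {structure_map \<phi> b i v})"

definition interval_basis ::
  "nat \<Rightarrow> (nat \<Rightarrow> ('a::field, 'b, 'm) module_scheme) \<Rightarrow> (nat \<Rightarrow> 'b \<Rightarrow> 'b) \<Rightarrow> (nat \<times> 'b) set \<Rightarrow> bool" where
  "interval_basis n M \<phi> V \<longleftrightarrow>
     finite V \<and>
     (\<forall>(b, v)\<in>V. b \<in> {1..n} \<and> v \<in> carrier (M b) \<and> v \<noteq> \<zero>\<^bsub>M b\<^esub>) \<and>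
     (\<forall>i\<in>{1..n}. internal_direct_sum (M i) V (interval_step M \<phi> i))"

section \<open>Matrix presentations\<close>

definition from_coords ::
  "(nat \<Rightarrow> ('a::field, 'b, 'm) module_scheme) \<Rightarrow> (nat \<Rightarrow> 'b list) \<Rightarrow> nat \<Rightarrow> 'a vec \<Rightarrow> 'b" where
  "from_coords M bs i x = finsum (M i) (\<lambda>j. x $ j \<odot>\<^bsub>M i\<^esub> (bs i ! j)) {..<length (bs i)}"

definition matrix_presentation ::
  "nat \<Rightarrow> (nat \<Rightarrow> ('a::field, 'b, 'm) module_scheme) \<Rightarrow> (nat \<Rightarrow> 'b \<Rightarrow> 'b) \<Rightarrow>
   (nat \<Rightarrow> 'b list) \<Rightarrow> (nat \<Rightarrow> 'a mat) \<Rightarrow> bool" where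
  "matrix_presentation n M \<phi> bs A \<longleftrightarrow>
     (\<forall>i\<le>n + 1. is_basis_list (M i) (carrier (M i)) (bs i)) \<and>
     (\<forall>i\<le>n. A i \<in> carrier_mat (length (bs (i + 1))) (length (bs i)) \<and>
        (\<forall>j<length (bs i). \<phi> i (bs i ! j) = from_coords M bs (i + 1) (col (A i) j)))"

section \<open>Basis completion\<close>

definition list_rank :: "nat \<Rightarrow> 'a::field vec list \<Rightarrow> nat" where
  "list_rank m xs = vec_space.rank m (mat_of_cols m xs)"

definition bca :: "nat \<Rightarrow> 'a::field vec list \<Rightarrow> 'a vec list \<Rightarrow> 'a vec list" where
  "bca m U W = snd (fold
     (\<lambda>w (U, R). if list_rank m U < list_rank m (U @ [w]) then (U @ [w], R @ [w]) else (U, R))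
     W (U, []))"

section \<open>Column reduction\<close>

text \<open>Columns and rows are numbered from 0; the lowest entry is the one with the largest row index.\<close>

definition zero_col :: "'a::zero mat \<Rightarrow> nat \<Rightarrow> bool" where
  "zero_col R t \<longleftrightarrow> col R t = 0\<^sub>v (dim_row R)"

definition low :: "'a::zero mat \<Rightarrow> nat \<Rightarrow> nat" where
  "low R t = Max {k. k < dim_row R \<and> R $$ (k, t) \<noteq> 0}"

definition cancels :: "'a::zero mat \<Rightarrow> nat set \<Rightarrow> nat \<Rightarrow> nat \<Rightarrow> bool" where
  "cancels R S t j \<longleftrightarrow> \<not> zero_col R t \<and> j \<in> S \<and> \<not> zero_col R j \<and> low R j = low R t"

text \<open>The columns in \<open>S\<close> are already reduced, so their lowest entries lie in distinct rows, and
  \<open>LEAST\<close> merely names the only possible column.\<close>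

definition reduce_once :: "nat set \<Rightarrow> nat \<Rightarrow> 'a::field mat \<times> 'a mat \<Rightarrow> 'a mat \<times> 'a mat" where
  "reduce_once S t = (\<lambda>(R, C).
     let j = (LEAST j. cancels R S t j);
         c = R $$ (low R t, t) / R $$ (low R t, j)
     in (addcol (- c) t j R, addcol (- c) t j C))"

definition reduce_col :: "nat set \<Rightarrow> nat \<Rightarrow> 'a::field mat \<times> 'a mat \<Rightarrow> 'a mat \<times> 'a mat" where
  "reduce_col S t = while (\<lambda>(R, C). \<exists>j. cancels R S t j) (reduce_once S t)"

definition column_reduction ::
  "'a::field mat \<Rightarrow> 'a mat \<Rightarrow> nat set \<Rightarrow> 'a mat \<times> 'a mat \<times> nat set" where
  "column_reduction R C I = fold
     (\<lambda>t (R, C, I'). if t \<in> I then (R, C, I') else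
        let (R', C') = reduce_col ({0..<t} - (I \<union> I')) t (R, C)
        in (R', C', if zero_col R' t then insert t I' else I'))
     [0..<dim_col R] (R, C, {})"

section \<open>Single step decomposition\<close>

record 'a ssd_state =
  st_R :: "'a mat"
  st_C :: "'a mat"
  st_r :: nat
  st_inds :: "nat set"
  st_U :: "'a vec list"
  st_birth :: "'a vec list"
  st_J :: "'a vec \<Rightarrow> nat"
  st_stop :: bool

text \<open>Here \<open>dim_col (A i)\<close> is the dimension of \<open>M i\<close>, and the list \<open>B\<close> is ordered by increasing
  column index.\<close>

definition ssd_step ::
  "(nat \<Rightarrow> 'a::field mat) \<Rightarrow> nat \<Rightarrow> nat \<Rightarrow> 'a ssd_state \<Rightarrow> 'a ssd_state" where
  "ssd_step A i s st =
     (let m = dim_col (A i);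
          k = vec_space.rank m (A (i - 1));
          (R, C, newInds) = column_reduction (A (i + s) * st_R st) (st_C st) (st_inds st);
          r' = st_r st - card newInds;
          st1 = st\<lparr>st_R := R, st_C := C\<rparr>;
          st2 = (if r' < st_r st then
                   let B = map (\<lambda>t. C *\<^sub>v unit_vec m t) (sorted_list_of_set newInds);
                       Bnew = bca m (st_U st) B
                   in st1\<lparr>st_U := st_U st @ Bnew,
                          st_birth := st_birth st @ Bnew,
                          st_J := (\<lambda>v. if v \<in> set Bnew then s + 1 else st_J st v),
                          st_r := r',
                          st_inds := st_inds st \<union> newInds\<rparr>
                 else st1)
      in st2\<lparr>st_stop := (st_r st2 = 0 \<or> length (st_birth st2) + k = m)\<rparr>)"

text \<open>\<open>U\<close> is the chosen basis of the image of \<open>A (i - 1)\<close>. The second component \<open>J\<close> of the result is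
  meaningful only on the vectors in the first.\<close>

definition ssd ::
  "nat \<Rightarrow> (nat \<Rightarrow> 'a::field mat) \<Rightarrow> 'a vec list \<Rightarrow> nat \<Rightarrow> 'a vec list \<times> ('a vec \<Rightarrow> nat)" where
  "ssd n A U i =
     (let m = dim_col (A i);
          st = fold (\<lambda>s st. if st_stop st then st else ssd_step A i s st) [0..<n - i + 1]
            \<lparr>st_R = 1\<^sub>m m, st_C = 1\<^sub>m m, st_r = m, st_inds = {}, st_U = U,
             st_birth = [], st_J = (\<lambda>_. 0), st_stop = False\<rparr>
      in (st_birth st, st_J st))"

section \<open>The decomposition algorithm\<close>

definition image_basis_choice ::
  "nat \<Rightarrow> (nat \<Rightarrow> 'a::field mat) \<Rightarrow> (nat \<Rightarrow> 'a vec list) \<Rightarrow> bool" where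
  "image_basis_choice n A U \<longleftrightarrow>
     (\<forall>i\<in>{1..n}. is_basis_list (module_vec TYPE('a) (dim_col (A i)))
        ((\<lambda>x. A (i - 1) *\<^sub>v x) ` carrier_vec (dim_col (A (i - 1)))) (U i))"

text \<open>The result consists of the homogeneous elements, in coordinates, and the list of intervals
  \<open>(i, i + J v)\<close>.\<close>

definition pm_decomposition ::
  "nat \<Rightarrow> (nat \<Rightarrow> 'a::field mat) \<Rightarrow> (nat \<Rightarrow> 'a vec list) \<Rightarrow> (nat \<times> 'a vec) set \<times> (nat \<times> nat) list" where
  "pm_decomposition n A U =
     ((\<Union>i\<in>{1..n}. Pair i ` set (fst (ssd n A (U i) i))),
      concat (map (\<lambda>i. case ssd n A (U i) i of (vs, J) \<Rightarrow> map (\<lambda>v. (i, i + J v)) vs) [1..<n + 1]))"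

definition returned_elements ::
  "nat \<Rightarrow> (nat \<Rightarrow> ('a::field, 'b, 'm) module_scheme) \<Rightarrow> (nat \<Rightarrow> 'b list) \<Rightarrow>
   (nat \<Rightarrow> 'a mat) \<Rightarrow> (nat \<Rightarrow> 'a vec list) \<Rightarrow> (nat \<times> 'b) set" where
  "returned_elements n M bs A U =
     (\<lambda>(i, x). (i, from_coords M bs i x)) ` fst (pm_decomposition n A U)"

end

theory Submission
  imports Defs
begin

text \<open>For fixed \<open>i\<close>, column reduction of \<open>\<phi>\<^sub>i\<^sub>,\<^sub>j\<close> writes the product as \<open>R = \<phi>\<^sub>i\<^sub>,\<^sub>j C\<close> with \<open>C\<close> invertible and
  the non-zero columns of \<open>R\<close> having distinct lowest entries; hence the columns of \<open>C\<close> over the zero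
  columns of \<open>R\<close> span \<open>ker \<phi>\<^sub>i\<^sub>,\<^sub>j\<close>. Basis completion therefore yields vectors \<open>V\<^sub>i\<close> that are linearly
  independent modulo \<open>im \<phi>\<^sub>i\<^sub>-\<^sub>1\<close> and such that \<open>ker \<phi>\<^sub>i\<^sub>,\<^sub>j \<subseteq> im \<phi>\<^sub>i\<^sub>-\<^sub>1 + \<langle>V\<^sub>i \<inter> ker \<phi>\<^sub>i\<^sub>,\<^sub>j\<rangle>\<close> for every \<open>j\<close>.
  These two properties make \<open>\<Union>\<^sub>i V\<^sub>i\<close> an interval basis: applying \<open>\<phi>\<^sub>i\<^sub>,\<^sub>j\<close>, the vectors of \<open>V\<^sub>i\<close> outside
  \<open>ker \<phi>\<^sub>i\<^sub>,\<^sub>j\<close> are mapped to a basis of \<open>\<phi>\<^sub>i\<^sub>,\<^sub>j(M\<^sub>i)\<close> modulo \<open>\<phi>\<^sub>i\<^sub>-\<^sub>1\<^sub>,\<^sub>j(M\<^sub>i\<^sub>-\<^sub>1)\<close>, and the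
  subspaces \<open>\<phi>\<^sub>i\<^sub>,\<^sub>j(M\<^sub>i)\<close> for \<open>i = 0, \<dots>, j\<close> form a filtration of \<open>M\<^sub>j\<close>.\<close>

section \<open>A criterion for interval bases\<close>

lemma (in linear_map) map_finsum:
  assumes "finite A" "f \<in> A \<rightarrow> carrier V"
  shows "T (finsum V f A) = finsum W (\<lambda>x. T (f x)) A"
  using assms
proof (induction A)
  case (insert x A)
  then have "f \<in> A \<rightarrow> carrier V" "f x \<in> carrier V" "(\<lambda>x. T (f x)) \<in> A \<rightarrow> carrier W" "T (f x) \<in> carrier W"
    by auto
  with insert show ?case
    by (simp add: V.module.M.finsum_insert W.module.M.finsum_insert)
qed simp

text \<open>Compares two expressions of one element after a common summand \<open>d\<close> has been
  split off. It produces the relation to which independence modulo an image is applied in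
  \<open>comb_eq_zeroD\<close>.\<close>

lemma (in abelian_group) sub_add_eq_zero:
  assumes "a \<in> carrier G" "b \<in> carrier G" "d \<in> carrier G" "u \<in> carrier G"
    and "a \<oplus> (b \<oplus> d) = u \<oplus> d"
  shows "(a \<ominus> u) \<oplus> b = \<zero>"
proof -
  have "(a \<oplus> b) \<oplus> d = u \<oplus> d"
    using assms by (simp add: a_assoc)
  then have "a \<oplus> b = u"
    using assms by simp
  moreover have "(a \<ominus> u) \<oplus> b = (a \<oplus> b) \<oplus> \<ominus> u"
    using assms by (simp add: minus_eq a_ac)
  ultimately show ?thesis
    using assms by (simp add: r_neg)
qed

lemma linear_mapI:
  assumes "vectorspace K V" "vectorspace K W" "T \<in> LinearCombinations.module_hom K V W"
  shows "linear_map K V W T"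
  using assms unfolding linear_map_def mod_hom_def mod_hom_axioms_def vectorspace_def by blast

section \<open>Composites of structure maps and their linearity\<close>

lemma structure_map_refl [simp]: "structure_map \<phi> i i v = v"
  by (simp add: structure_map_def)

lemma structure_map_Suc: "i \<le> j \<Longrightarrow> structure_map \<phi> i (Suc j) v = \<phi> j (structure_map \<phi> i j v)"
  by (simp add: structure_map_def)

lemma structure_map_rec: "i < j \<Longrightarrow> structure_map \<phi> i j v = structure_map \<phi> (Suc i) j (\<phi> i v)"
  by (simp add: structure_map_def upt_conv_Cons)

lemma structure_map_trans:
  assumes "i \<le> j" "j \<le> k"
  shows "structure_map \<phi> i k v = structure_map \<phi> j k (structure_map \<phi> i j v)"
  using assms(2)
  by (induction k rule: dec_induct) (use assms(1) in \<open>simp_all add: structure_map_Suc\<close>)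

locale persistence =
  fixes n :: nat
    and M :: "nat \<Rightarrow> ('a::field, 'b, 'm) module_scheme"
    and \<phi> :: "nat \<Rightarrow> 'b \<Rightarrow> 'b"
  assumes pm: "persistence_module n M \<phi>"
begin

lemma vs: "i \<le> n + 1 \<Longrightarrow> vectorspace class_ring (M i)"
  and lm: "i \<le> n \<Longrightarrow> linear_map class_ring (M i) (M (i + 1)) (\<phi> i)"
  and M_0: "carrier (M 0) = {\<zero>\<^bsub>M 0\<^esub>}"
  and M_end: "carrier (M (n + 1)) = {\<zero>\<^bsub>M (n + 1)\<^esub>}"
  using pm by (auto simp: persistence_module_def)

lemma linear_map_structure_map:
  assumes "i \<le> j" "j \<le> n + 1"
  shows "linear_map class_ring (M i) (M j) (structure_map \<phi> i j)"
  using assms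
proof (induction j rule: dec_induct)
  case base
  then show ?case
    using vs[of i] by (intro linear_mapI) (auto simp: LinearCombinations.module_hom_def)
next
  case (step j)
  interpret T: linear_map class_ring "M i" "M j" "structure_map \<phi> i j" using step by simp
  interpret S: linear_map class_ring "M j" "M (Suc j)" "\<phi> j" using lm[of j] step by simp
  show ?case
    by (rule linear_mapI[OF vs vs])
      (use step in \<open>auto simp: LinearCombinations.module_hom_def structure_map_Suc\<close>)
qed

lemma structure_map_closed:
  "i \<le> j \<Longrightarrow> j \<le> n + 1 \<Longrightarrow> v \<in> carrier (M i) \<Longrightarrow> structure_map \<phi> i j v \<in> carrier (M j)"
  by (rule mod_hom.f_im[OF linear_map.axioms(3)[OF linear_map_structure_map]])

end

text \<open>Isolates what the algorithm has to deliver at each step. \<open>indep\<close> is linear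
  independence of \<open>V i\<close> modulo the image of \<open>\<phi> (i - 1)\<close>.
  \<open>kernel\<close> says that every vector dead at \<open>j\<close> is, modulo this image, a
  combination of elements of \<open>V i\<close> that are themselves dead at \<open>j\<close>. Its
  instance \<open>j = n + 1\<close>, where the target is zero, gives spanning modulo the
  image.\<close>

locale persistence_generators = persistence n M \<phi>
  for n and M :: "nat \<Rightarrow> ('a::field, 'b, 'm) module_scheme" and \<phi> +
  fixes V :: "nat \<Rightarrow> 'b set"
  assumes V: "i \<in> {1..n} \<Longrightarrow> finite (V i) \<and> V i \<subseteq> carrier (M i)"
    and indep: "\<lbrakk>i \<in> {1..n}; u \<in> carrier (M (i - 1));
        \<phi> (i - 1) u \<oplus>\<^bsub>M i\<^esub> finsum (M i) (\<lambda>v. c v \<odot>\<^bsub>M i\<^esub> v) (V i) = \<zero>\<^bsub>M i\<^esub>; v \<in> V i\<rbrakk> \<Longrightarrow> c v = 0"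
    and kernel: "\<lbrakk>i \<in> {1..n}; i \<le> j; j \<le> n + 1; x \<in> carrier (M i);
        structure_map \<phi> i j x = \<zero>\<^bsub>M j\<^esub>\<rbrakk> \<Longrightarrow>
        \<exists>u \<in> carrier (M (i - 1)). \<exists>c. x = \<phi> (i - 1) u \<oplus>\<^bsub>M i\<^esub> finsum (M i) (\<lambda>v. c v \<odot>\<^bsub>M i\<^esub> v) (V i) \<and>
          (\<forall>v\<in>V i. c v \<noteq> 0 \<longrightarrow> structure_map \<phi> i j v = \<zero>\<^bsub>M j\<^esub>)"
begin

section \<open>Linear combinations of generators along the image filtration\<close>

definition gens :: "nat \<Rightarrow> (nat \<times> 'b) set" where
  "gens k = Sigma {1..k} V"

text \<open>The bound \<open>k\<close> on the birth index and the place \<open>j\<close> of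
  evaluation are separate: structure maps then change only \<open>j\<close>, while the filtration of
  \<open>M j\<close> by images is traversed by changing only \<open>k\<close>.\<close>

definition comb :: "(nat \<times> 'b \<Rightarrow> 'a) \<Rightarrow> nat \<Rightarrow> nat \<Rightarrow> 'b" where
  "comb c k j = finsum (M j) (\<lambda>(b, v). c (b, v) \<odot>\<^bsub>M j\<^esub> structure_map \<phi> b j v) (gens k)"

lemma finite_gens: "k \<le> n \<Longrightarrow> finite (gens k)"
  using V by (auto simp: gens_def intro!: finite_SigmaI)

lemma gens_Suc: "gens (Suc k) = gens k \<union> Pair (Suc k) ` V (Suc k)"
  by (auto simp: gens_def le_Suc_eq)

lemma scale_closed: "j \<le> n + 1 \<Longrightarrow> v \<in> carrier (M j) \<Longrightarrow> (a :: 'a) \<odot>\<^bsub>M j\<^esub> v \<in> carrier (M j)"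
  using module.smult_closed[OF vectorspace.axioms(1)[OF vs], of j a v] by (simp add: class_ring_simps)

lemma V_closed: "1 \<le> b \<Longrightarrow> b \<le> n \<Longrightarrow> v \<in> V b \<Longrightarrow> v \<in> carrier (M b)"
  using V[of b] by auto

lemma term_closed:
  "(b, v) \<in> gens k \<Longrightarrow> k \<le> n \<Longrightarrow> k \<le> j \<Longrightarrow> j \<le> n + 1 \<Longrightarrow>
   a \<odot>\<^bsub>M j\<^esub> structure_map \<phi> b j v \<in> carrier (M j)"
  using V_closed[of b v] by (intro scale_closed structure_map_closed) (auto simp: gens_def)

lemma gens_term_closed:
  "k \<le> n \<Longrightarrow> k \<le> j \<Longrightarrow> j \<le> n + 1 \<Longrightarrow>
   (\<lambda>(b, v). c (b, v) \<odot>\<^bsub>M j\<^esub> structure_map \<phi> b j v) \<in> gens k \<rightarrow> carrier (M j)"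
  by (auto intro!: term_closed)

lemma comb_closed:
  assumes "k \<le> n" "k \<le> j" "j \<le> n + 1"
  shows "comb c k j \<in> carrier (M j)"
proof -
  interpret vectorspace class_ring "M j" using vs assms by simp
  show ?thesis unfolding comb_def using gens_term_closed[OF assms] by (rule module.M.finsum_closed)
qed

lemma structure_map_comb:
  assumes "k \<le> n" "k \<le> i" "i \<le> j" "j \<le> n + 1"
  shows "structure_map \<phi> i j (comb c k i) = comb c k j"
proof -
  interpret linear_map class_ring "M i" "M j" "structure_map \<phi> i j"
    using linear_map_structure_map assms by simp
  show ?thesis unfolding comb_def
  proof (subst map_finsum, goal_cases)
    case 3 show ?case
    proof (rule W.module.M.finsum_cong', goal_cases)
      case 2 show ?case
        using assms by (auto intro!: term_closed)
    next
      case (3 p)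
      obtain b v where p: "p = (b, v)" by force
      show ?case
        using 3 assms structure_map_trans[of b i j \<phi> v] V_closed[of b v]
          structure_map_closed[of b i v] 
        by (auto simp: p gens_def class_ring_simps)
    qed simp
  qed (use finite_gens gens_term_closed[of k i] assms in auto)
qed

text \<open>Generators born before \<open>Suc k\<close> arrive through \<open>\<phi> k\<close>; on
  those born at \<open>Suc k\<close> the structure map is the identity. This is one step of the
  filtration, in the shape that \<open>indep\<close> and \<open>kernel\<close> refer to.\<close>

lemma comb_Suc:
  assumes "Suc k \<le> n"
  shows "comb c (Suc k) (Suc k) = \<phi> k (comb c k k) \<oplus>\<^bsub>M (Suc k)\<^esub>
    finsum (M (Suc k)) (\<lambda>v. c (Suc k, v) \<odot>\<^bsub>M (Suc k)\<^esub> v) (V (Suc k))"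
proof -
  interpret vectorspace class_ring "M (Suc k)" using vs assms by simp
  have cl: "(\<lambda>(b, v). c (b, v) \<odot>\<^bsub>M (Suc k)\<^esub> structure_map \<phi> b (Suc k) v) \<in> gens (Suc k) \<rightarrow> carrier (M (Suc k))"
    using gens_term_closed[of "Suc k" "Suc k" c] assms by auto
  have "comb c (Suc k) (Suc k) = comb c k (Suc k) \<oplus>\<^bsub>M (Suc k)\<^esub>
     finsum (M (Suc k)) (\<lambda>(b, v). c (b, v) \<odot>\<^bsub>M (Suc k)\<^esub> structure_map \<phi> b (Suc k) v) (Pair (Suc k) ` V (Suc k))"
    unfolding comb_def gens_Suc
    by (rule module.M.finsum_Un_disjoint)
      (use cl V[of "Suc k"] assms finite_gens[of k] in \<open>auto simp: gens_Suc intro!: term_closed[of _ _ k], auto simp: gens_def\<close>)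
  also have "comb c k (Suc k) = \<phi> k (comb c k k)"
    using structure_map_comb[of k k "Suc k" c] assms by (simp add: structure_map_Suc)
  also have "finsum (M (Suc k)) (\<lambda>(b, v). c (b, v) \<odot>\<^bsub>M (Suc k)\<^esub> structure_map \<phi> b (Suc k) v) (Pair (Suc k) ` V (Suc k))
     = finsum (M (Suc k)) (\<lambda>v. c (Suc k, v) \<odot>\<^bsub>M (Suc k)\<^esub> v) (V (Suc k))"
    by (subst module.M.finsum_reindex)
      (use V[of "Suc k"] assms scale_closed[of "Suc k"] in \<open>auto simp: inj_on_def\<close>)
  finally show ?thesis .
qed

text \<open>Every vector dies in the zero space \<open>M (n + 1)\<close>, so \<open>kernel\<close>
  writes it as an image under the preceding map plus a combination of new generators. The induction
  hypothesis handles the preimage.\<close>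

lemma comb_spans:
  assumes "j \<le> n" "x \<in> carrier (M j)"
  shows "\<exists>c. comb c j j = x"
  using assms
proof (induction j arbitrary: x)
  case 0
  then have "comb c 0 0 = x" for c
    using M_0 comb_closed[of 0 0 c] by simp
  then show ?case by blast
next
  case (Suc j)
  have "structure_map \<phi> (Suc j) (n + 1) x = \<zero>\<^bsub>M (n + 1)\<^esub>"
    using structure_map_closed[of "Suc j" "n + 1" x] Suc M_end by simp
  then obtain u d where u: "u \<in> carrier (M j)"
    and x: "x = \<phi> j u \<oplus>\<^bsub>M (Suc j)\<^esub> finsum (M (Suc j)) (\<lambda>v. d v \<odot>\<^bsub>M (Suc j)\<^esub> v) (V (Suc j))"
    using kernel[of "Suc j" "n + 1" x] Suc by auto
  obtain c where c: "comb c j j = u" using Suc u by auto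
  \<comment> \<open>The birth index \<open>Suc j\<close> does not occur in \<open>gens j\<close>, so
    overriding the coefficients there leaves the combination at \<open>j\<close> unchanged.\<close>
  define c' where "c' = (\<lambda>(b, v). if b = Suc j then d v else c (b, v))"
  have "comb c' j j = comb c j j"
  proof -
    interpret vectorspace class_ring "M j" using vs Suc by simp
    show ?thesis unfolding comb_def
      by (rule module.M.finsum_cong') (use Suc in
          \<open>auto simp: c'_def intro!: term_closed, auto simp: gens_def\<close>)
  qed
  then have "comb c' (Suc j) (Suc j) = x"
    using comb_Suc[of j c'] Suc.prems x c by (simp add: c'_def)
  then show ?case by blast
qed

text \<open>With \<open>j\<close> fixed, the latest generators are peeled off. The combination
  evaluated at \<open>Suc k\<close> lies in the kernel of the map to \<open>M j\<close>, so
  \<open>kernel\<close> gives a second expression of it using only generators dead at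
  \<open>j\<close>; \<open>indep\<close> forces the two to agree on \<open>V (Suc k)\<close>. The
  latest terms therefore vanish in \<open>M j\<close>, and the induction continues with the rest.
  Only terms, not coefficients, can be shown to vanish, since a dead generator may carry any
  scalar.\<close>

lemma comb_eq_zeroD:
  assumes "k \<le> j" "j \<le> n" "comb c k j = \<zero>\<^bsub>M j\<^esub>" "(b, v) \<in> gens k"
  shows "c (b, v) \<odot>\<^bsub>M j\<^esub> structure_map \<phi> b j v = \<zero>\<^bsub>M j\<^esub>"
  using assms
proof (induction k arbitrary: b v)
  case 0
  then show ?case by (simp add: gens_def)
next
  case (Suc k)
  let ?i = "Suc k"
  interpret Mi: vectorspace class_ring "M ?i" using vs Suc by simp
  interpret Mj: vectorspace class_ring "M j" using vs Suc by simp
  interpret L: linear_map class_ring "M k" "M ?i" "\<phi> k" using lm[of k] Suc by simp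
  interpret S: linear_map class_ring "M ?i" "M j" "structure_map \<phi> ?i j"
    using linear_map_structure_map Suc by simp
  let ?f = "\<lambda>d. finsum (M ?i) (\<lambda>v. d v \<odot>\<^bsub>M ?i\<^esub> v) (V ?i)"
  let ?x = "comb c ?i ?i"
  have V': "finite (V ?i)" "V ?i \<subseteq> carrier (M ?i)" using V[of ?i] Suc by auto
  have x: "?x \<in> carrier (M ?i)" using comb_closed Suc by simp
  have ck: "comb c k k \<in> carrier (M k)" using comb_closed Suc by simp
  have fc: "?f d \<in> carrier (M ?i)" for d
    by (rule Mi.module.M.finsum_closed) (use V' Suc scale_closed[of ?i] in auto)
  have "structure_map \<phi> ?i j ?x = \<zero>\<^bsub>M j\<^esub>"
    using structure_map_comb[of ?i ?i j c] Suc by simp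
  then obtain u d where u: "u \<in> carrier (M k)" and xu: "?x = \<phi> k u \<oplus>\<^bsub>M ?i\<^esub> ?f d"
    and d: "\<And>v. v \<in> V ?i \<Longrightarrow> d v \<noteq> 0 \<Longrightarrow> structure_map \<phi> ?i j v = \<zero>\<^bsub>M j\<^esub>"
    using kernel[of ?i j ?x] Suc.prems x by auto
  have "?f (\<lambda>v. c (?i, v)) = ?f (\<lambda>v. c (?i, v) - d v) \<oplus>\<^bsub>M ?i\<^esub> ?f d"
  proof -
    have "?f (\<lambda>v. c (?i, v) - d v) \<oplus>\<^bsub>M ?i\<^esub> ?f d = 
      finsum (M ?i) (\<lambda>v. (c (?i, v) - d v) \<odot>\<^bsub>M ?i\<^esub> v \<oplus>\<^bsub>M ?i\<^esub> d v \<odot>\<^bsub>M ?i\<^esub> v) (V ?i)"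
      by (rule Mi.module.M.finsum_addf[symmetric]) (use V' Suc scale_closed[of ?i] in auto)
    also have "\<dots> = ?f (\<lambda>v. c (?i, v))"
    proof (rule Mi.module.M.finsum_cong'[OF refl])
      show "(\<lambda>v. c (?i, v) \<odot>\<^bsub>M ?i\<^esub> v) \<in> V ?i \<rightarrow> carrier (M ?i)"
        using V' Suc scale_closed[of ?i] by auto
      show "v \<in> V ?i \<Longrightarrow> (c (?i, v) - d v) \<odot>\<^bsub>M ?i\<^esub> v \<oplus>\<^bsub>M ?i\<^esub> d v \<odot>\<^bsub>M ?i\<^esub> v = c (?i, v) \<odot>\<^bsub>M ?i\<^esub> v" for v
        using V' Mi.smult_l_distr[of "c (?i, v) - d v" "d v" v]
        by (auto simp: class_ring_simps)
    qed
    finally show ?thesis by simp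
  qed
  then have *: "\<phi> k (comb c k k) \<oplus>\<^bsub>M ?i\<^esub> (?f (\<lambda>v. c (?i, v) - d v) \<oplus>\<^bsub>M ?i\<^esub> ?f d) = \<phi> k u \<oplus>\<^bsub>M ?i\<^esub> ?f d"
    using xu comb_Suc[of k c] Suc by simp
  \<comment> \<open>Subtracting the two expressions leaves a relation between the image of
    \<open>\<phi> k\<close> and the new generators with coefficients \<open>c - d\<close>, to which
    \<open>indep\<close> applies.\<close>
  have "\<phi> k (comb c k k \<ominus>\<^bsub>M k\<^esub> u) \<oplus>\<^bsub>M ?i\<^esub> ?f (\<lambda>v. c (?i, v) - d v) = \<zero>\<^bsub>M ?i\<^esub>"
    using Mi.module.M.sub_add_eq_zero[OF L.f_im[OF ck] fc fc L.f_im[OF u] *] L.f_minus[OF ck u] by simp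
  then have cd: "c (?i, v) = d v" if "v \<in> V ?i" for v
    using indep[of ?i "comb c k k \<ominus>\<^bsub>M k\<^esub> u" "\<lambda>v. c (?i, v) - d v" v] that ck u Suc by auto
  have last: "c (?i, v) \<odot>\<^bsub>M j\<^esub> structure_map \<phi> ?i j v = \<zero>\<^bsub>M j\<^esub>" if "v \<in> V ?i" for v
  proof (cases "d v = 0")
    case True
    then show ?thesis using cd[OF that] Mj.lmult_0[of "structure_map \<phi> ?i j v"] that V'
      by (auto simp: class_ring_simps)
  next
    case False
    then show ?thesis using d[OF that] Mj.rmult_0 by (simp add: class_ring_simps)
  qed
  have "structure_map \<phi> ?i j (?f (\<lambda>v. c (?i, v))) = \<zero>\<^bsub>M j\<^esub>"
    by (subst S.map_finsum, insert V' Suc scale_closed[of ?i] last)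
       (auto intro!: Mj.module.M.add.finprod_one_eqI simp: class_ring_simps subset_iff)
  \<comment> \<open>The part born at \<open>Suc k\<close> is already zero in \<open>M j\<close>, so
    the image of \<open>?x\<close> is that of the older generators alone, and the induction
    hypothesis becomes applicable.\<close>
  then have "structure_map \<phi> ?i j ?x = structure_map \<phi> ?i j (\<phi> k (comb c k k))"
    using comb_Suc[of k c] Suc fc L.f_im[OF ck] S.f_im[OF L.f_im[OF ck]] by simp
  also have "\<dots> = comb c k j"
    using structure_map_comb[of k k j c] structure_map_rec[of k j \<phi>] Suc by simp
  finally have "comb c k j = \<zero>\<^bsub>M j\<^esub>" using \<open>structure_map \<phi> ?i j ?x = \<zero>\<^bsub>M j\<^esub>\<close> by simp
  then show ?case using Suc last by (auto simp: gens_Suc)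
qed

text \<open>Applies \<open>comb_eq_zeroD\<close> to the difference of the coefficient functions.
  Equality of terms is exactly the uniqueness required of a direct sum of the interval
  steps.\<close>

lemma comb_inject:
  assumes "j \<le> n" "comb c j j = comb d j j" "(b, v) \<in> gens j"
  shows "c (b, v) \<odot>\<^bsub>M j\<^esub> structure_map \<phi> b j v = d (b, v) \<odot>\<^bsub>M j\<^esub> structure_map \<phi> b j v"
proof -
  interpret vectorspace class_ring "M j" using vs assms by simp
  have add: "(c p - d p) \<odot>\<^bsub>M j\<^esub> w \<oplus>\<^bsub>M j\<^esub> d p \<odot>\<^bsub>M j\<^esub> w = c p \<odot>\<^bsub>M j\<^esub> w"
    if "w \<in> carrier (M j)" for p w
    using smult_l_distr[of "c p - d p" "d p" w] that by (simp add: class_ring_simps)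
  have cl: "structure_map \<phi> b j v \<in> carrier (M j)" if "(b, v) \<in> gens j" for b v
    using that V_closed[of b v] assms(1) by (intro structure_map_closed) (auto simp: gens_def)
  have "comb (\<lambda>p. c p - d p) j j \<oplus>\<^bsub>M j\<^esub> comb d j j = comb c j j"
    unfolding comb_def
  proof (subst module.M.finsum_addf[symmetric], goal_cases)
    case 3 show ?case
      by (rule module.M.finsum_cong') (use assms add cl gens_term_closed[of j j] in auto)
  qed (use assms in \<open>auto intro!: term_closed\<close>)
  then have "comb (\<lambda>p. c p - d p) j j = \<zero>\<^bsub>M j\<^esub>"
    using assms comb_closed[of j j] by (simp add: module.M.add.r_cancel_one)
  then have "(c (b, v) - d (b, v)) \<odot>\<^bsub>M j\<^esub> structure_map \<phi> b j v = \<zero>\<^bsub>M j\<^esub>"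
    using comb_eq_zeroD[of j j "\<lambda>p. c p - d p" b v] assms by simp
  then show ?thesis
    using add[OF cl[OF assms(3)], of "(b, v)"] scale_closed[of j, OF _ cl[OF assms(3)]] assms
    by simp
qed

section \<open>The direct sum decomposition of each space\<close>

lemma interval_step_eq:
  assumes "j \<le> n" "(b, v) \<in> gens n"
  shows "interval_step M \<phi> j (b, v) =
    (if b \<le> j then range (\<lambda>a. a \<odot>\<^bsub>M j\<^esub> structure_map \<phi> b j v) else {\<zero>\<^bsub>M j\<^esub>})"
proof (cases "b \<le> j")
  case True
  interpret vectorspace class_ring "M j" using vs assms by simp
  let ?w = "structure_map \<phi> b j v"
  have w: "?w \<in> carrier (M j)"
    using assms V_closed[of b v] True by (intro structure_map_closed) (auto simp: gens_def)
  have l: "lincomb a {?w} = a ?w \<odot>\<^bsub>M j\<^esub> ?w" for a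
    using scale_closed[of j ?w "a ?w"] w assms by (simp add: lincomb_def)
  have "x \<in> {lincomb a {?w} |a. a \<in> {?w} \<rightarrow> carrier class_ring}" 
    if "x = a \<odot>\<^bsub>M j\<^esub> ?w" for x a
    using l[of "\<lambda>_. a"] that by (auto simp: class_ring_simps intro!: exI[of _ "\<lambda>_. a"])
  then have "span {?w} = range (\<lambda>a. a \<odot>\<^bsub>M j\<^esub> ?w)"
    using w l by (subst finite_span) (auto simp: class_ring_simps)
  then show ?thesis using True by (simp add: interval_step_def)
qed (simp add: interval_step_def)

lemma interval_step_subspace:
  assumes "j \<le> n" "(b, v) \<in> gens n"
  shows "subspace class_ring (interval_step M \<phi> j (b, v)) (M j)"
proof -
  interpret vectorspace class_ring "M j" using vs assms by simp
  show ?thesis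
  proof (cases "b \<le> j")
    case True
    then have "structure_map \<phi> b j v \<in> carrier (M j)"
      using assms V_closed[of b v] by (intro structure_map_closed) (auto simp: gens_def)
    then show ?thesis
      using True span_is_subspace[of "{structure_map \<phi> b j v}"] by (simp add: interval_step_def)
  next
    case False
    then show ?thesis
      using span_is_subspace[of "{}"] span_empty by (simp add: interval_step_def)
  qed
qed

text \<open>Passes from a family indexed by all generators, as in the definition of an interval
  basis, to a combination of those born up to \<open>j\<close>; the later ones contribute
  zero.\<close>

lemma finsum_eq_comb:
  assumes "j \<le> n"
    and "\<And>b v. (b, v) \<in> gens n \<Longrightarrow> b \<le> j \<Longrightarrow> f (b, v) = c (b, v) \<odot>\<^bsub>M j\<^esub> structure_map \<phi> b j v"
    and "\<And>b v. (b, v) \<in> gens n \<Longrightarrow> j < b \<Longrightarrow> f (b, v) = \<zero>\<^bsub>M j\<^esub>"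
  shows "finsum (M j) f (gens n) = comb c j j"
proof -
  interpret vectorspace class_ring "M j" using vs assms by simp
  have sub: "gens j \<subseteq> gens n" using assms by (auto simp: gens_def)
  have "f p \<in> carrier (M j)" if "p \<in> gens n" for p
  proof (cases p)
    case (Pair b v)
    show ?thesis
    proof (cases "b \<le> j")
      case True
      then have "(b, v) \<in> gens j" using that Pair by (auto simp: gens_def)
      then show ?thesis using term_closed[of b v j j] assms that Pair True by simp
    qed (use assms that Pair in simp)
  qed
  moreover have "f p = \<zero>\<^bsub>M j\<^esub>" if "p \<in> gens n - gens j" for p
    using that assms(3)[of "fst p" "snd p"] by (cases p) (auto simp: gens_def not_le)
  moreover have "f (b, v) = c (b, v) \<odot>\<^bsub>M j\<^esub> structure_map \<phi> b j v" if "(b, v) \<in> gens j" for b v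
    using that assms(1) assms(2)[of b v] by (auto simp: gens_def)
  ultimately show ?thesis unfolding comb_def
    by (intro module.M.add.finprod_mono_neutral_cong_left[symmetric])
      (use sub finite_gens in auto)
qed

text \<open>Existence of the decomposition comes from \<open>comb_spans\<close> and uniqueness from
  \<open>comb_inject\<close>, once members of the interval steps are written as scalar
  multiples.\<close>

theorem interval_basis_gens: "interval_basis n M \<phi> (gens n)"
  unfolding interval_basis_def
proof (intro conjI ballI)
  show "finite (gens n)" by (simp add: finite_gens)
next
  fix p assume "p \<in> gens n"
  then obtain b v where p: "p = (b, v)" "b \<in> {1..n}" "v \<in> V b" by (auto simp: gens_def)
  interpret Mb: vectorspace class_ring "M b" using vs p by simp
  interpret L: linear_map class_ring "M (b - 1)" "M b" "\<phi> (b - 1)"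
    using lm[of "b - 1"] p by (cases b) auto
  have "v \<noteq> \<zero>\<^bsub>M b\<^esub>"
  proof
    assume "v = \<zero>\<^bsub>M b\<^esub>"
    \<comment> \<open>If \<open>v\<close> were zero, the coefficient function supported at
      \<open>v\<close> would give a relation with \<open>u\<close> zero, contradicting
      \<open>indep\<close>.\<close>
    let ?c = "\<lambda>w. if w = v then 1 else 0 :: 'a"
    have "finsum (M b) (\<lambda>w. ?c w \<odot>\<^bsub>M b\<^esub> w) (V b) = \<zero>\<^bsub>M b\<^esub>"
      by (rule Mb.module.M.add.finprod_one_eqI)
        (use V[of b] p Mb.lmult_0 Mb.rmult_0 \<open>v = _\<close> in \<open>auto simp: class_ring_simps subset_iff\<close>)
    then show False using indep[of b "\<zero>\<^bsub>M (b - 1)\<^esub>" ?c v] p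
        L.f0_is_0 L.V.module.M.zero_closed by auto
  qed
  then show "case p of (b, v) \<Rightarrow> b \<in> {1..n} \<and> v \<in> carrier (M b) \<and> v \<noteq> \<zero>\<^bsub>M b\<^esub>"
    using p V_closed[of b v] by simp
next
  fix j assume j: "j \<in> {1..n}"
  interpret vectorspace class_ring "M j" using vs j by simp
  let ?W = "interval_step M \<phi> j"
  show "internal_direct_sum (M j) (gens n) ?W"
    unfolding internal_direct_sum_def
  proof (intro conjI ballI)
    show "subspace class_ring (?W p) (M j)" if "p \<in> gens n" for p
      using that j interval_step_subspace[of j "fst p" "snd p"] by simp
  next
    fix x assume x: "x \<in> carrier (M j)"
    obtain c where c: "comb c j j = x" using comb_spans[of j x] x j by auto
    \<comment> \<open>Restriction makes the family extensional, and generators not yet born at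
      \<open>j\<close> get the only value their interval step allows.\<close>
    define f where "f = restrict (\<lambda>(b, v). if b \<le> j then c (b, v) \<odot>\<^bsub>M j\<^esub> structure_map \<phi> b j v else \<zero>\<^bsub>M j\<^esub>) (gens n)"
    have f: "f \<in> Pi\<^sub>E (gens n) ?W" "finsum (M j) f (gens n) = x"
      using j c finsum_eq_comb[of j f c] by (auto simp: f_def interval_step_eq)
    show "\<exists>!f. f \<in> Pi\<^sub>E (gens n) ?W \<and> finsum (M j) f (gens n) = x"
    proof (rule ex1I[of _ f])
      fix g assume g: "g \<in> Pi\<^sub>E (gens n) ?W \<and> finsum (M j) g (gens n) = x"
      then have W: "g p \<in> ?W p" if "p \<in> gens n" for p
        using that by auto
      have "\<forall>p\<in>gens n. \<exists>a. fst p \<le> j \<longrightarrow> g p = a \<odot>\<^bsub>M j\<^esub> structure_map \<phi> (fst p) j (snd p)"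
      proof
        fix p assume p: "p \<in> gens n"
        show "\<exists>a. fst p \<le> j \<longrightarrow> g p = a \<odot>\<^bsub>M j\<^esub> structure_map \<phi> (fst p) j (snd p)"
          using W[OF p] interval_step_eq[of j "fst p" "snd p"] j p by (auto split: if_splits)
      qed
      \<comment> \<open>A scalar is chosen for each generator. For those born after \<open>j\<close>
        it is arbitrary, which is harmless because \<open>comb d j j\<close> does not involve
        them.\<close>
      then obtain d where
        d: "\<And>p. p \<in> gens n \<Longrightarrow> fst p \<le> j \<Longrightarrow> g p = d p \<odot>\<^bsub>M j\<^esub> structure_map \<phi> (fst p) j (snd p)"
        by metis
      have z: "g (b, v) = \<zero>\<^bsub>M j\<^esub>" if "(b, v) \<in> gens n" "j < b" for b v
        using W[OF that(1)] interval_step_eq[OF _ that(1), of j] that j by simp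
      have "comb d j j = x"
        using finsum_eq_comb[of j g d] d z g j by (metis atLeastAtMost_iff fst_conv snd_conv)
      then have cd: "comb d j j = comb c j j" using c by simp
      show "g = f"
      proof (rule PiE_ext)
        fix p assume p: "p \<in> gens n"
        obtain b v where bv: "p = (b, v)" by force
        show "g p = f p"
        proof (cases "b \<le> j")
          case True
          then have "(b, v) \<in> gens j" using p bv by (auto simp: gens_def)
          then show ?thesis using comb_inject[OF _ cd, of b v] d[OF p] p bv j True by (simp add: f_def)
        next
          case False
          then show ?thesis using z[of b v] p bv by (simp add: f_def)
        qed
      qed (use g f in auto)
    qed (use f in auto)
  qed
qed

end

section \<open>Column reduction\<close>

lemma zero_col_iff:
  "t < dim_col R \<Longrightarrow> zero_col R t \<longleftrightarrow> (\<forall>k<dim_row R. R $$ (k, t) = 0)"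
  by (auto simp: zero_col_def vec_eq_iff)

lemma low_nonzero:
  assumes "t < dim_col R" "\<not> zero_col R t"
  shows "low R t < dim_row R" "R $$ (low R t, t) \<noteq> 0"
proof -
  have "low R t \<in> {k. k < dim_row R \<and> R $$ (k, t) \<noteq> 0}"
    unfolding low_def using assms by (intro Max_in) (auto simp: zero_col_iff)
  then show "low R t < dim_row R" "R $$ (low R t, t) \<noteq> 0" by auto
qed

lemma below_low_zero:
  assumes "k < dim_row R" "low R t < k"
  shows "R $$ (k, t) = 0"
proof (rule ccontr)
  assume "R $$ (k, t) \<noteq> 0"
  then have "k \<le> low R t"
    unfolding low_def using assms by (intro Max_ge) auto
  then show False using assms by simp
qed

lemma col_eq_low_zero_col:
  assumes "dim_row R = dim_row R'" "t < dim_col R" "t < dim_col R'" "col R t = col R' t"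
  shows "low R t = low R' t" "zero_col R t = zero_col R' t"
proof -
  have "R $$ (k, t) = R' $$ (k, t)" if "k < dim_row R" for k
    using that assms by (metis index_col)
  then have "{k. k < dim_row R \<and> R $$ (k, t) \<noteq> 0} = {k. k < dim_row R' \<and> R' $$ (k, t) \<noteq> 0}"
    using assms by auto
  then show "low R t = low R' t" by (simp add: low_def)
  show "zero_col R t = zero_col R' t" using assms by (simp add: zero_col_def)
qed

text \<open>The same invertible \<open>E\<close> acts on both matrices, which preserves a relation
  \<open>R = P * C\<close>. For square matrices the right inverse \<open>D\<close> is a two-sided
  one, so a single equation encodes invertibility.\<close>

definition column_equivalent :: "nat \<Rightarrow> 'a::field mat \<times> 'a mat \<Rightarrow> 'a mat \<times> 'a mat \<Rightarrow> bool" where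
  "column_equivalent m = (\<lambda>(R, C) (R', C'). \<exists>E D. E \<in> carrier_mat m m \<and> D \<in> carrier_mat m m \<and>
     E * D = 1\<^sub>m m \<and> R' = R * E \<and> C' = C * E)"

lemma column_equivalent_refl:
  "R \<in> carrier_mat r m \<Longrightarrow> C \<in> carrier_mat m m \<Longrightarrow> column_equivalent m (R, C) (R, C)"
  by (auto simp: column_equivalent_def intro!: exI[of _ "1\<^sub>m m"])

lemma column_equivalent_trans:
  assumes "R \<in> carrier_mat r m" "C \<in> carrier_mat c m"
    and "column_equivalent m (R, C) (R', C')" "column_equivalent m (R', C') (R'', C'')"
  shows "column_equivalent m (R, C) (R'', C'')"
proof -
  from assms(3) obtain E D where 1: "E \<in> carrier_mat m m" "D \<in> carrier_mat m m" "E * D = 1\<^sub>m m"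
    "R' = R * E" "C' = C * E"
    by (auto simp: column_equivalent_def)
  from assms(4) obtain E' D' where 2: "E' \<in> carrier_mat m m" "D' \<in> carrier_mat m m" "E' * D' = 1\<^sub>m m"
    "R'' = R' * E'" "C'' = C' * E'"
    by (auto simp: column_equivalent_def)
  have "E' * (D' * D) = D"
    using 1 2 by (simp flip: assoc_mult_mat[of _ m m _ m _ m])
  then have "(E * E') * (D' * D) = 1\<^sub>m m"
    using 1 2 by (simp add: assoc_mult_mat[of _ m m _ m _ m])
  moreover have "R'' = R * (E * E')" "C'' = C * (E * E')"
    using assms 1 2 by (simp_all add: assoc_mult_mat[of _ _ m _ m _ m])
  moreover have "E * E' \<in> carrier_mat m m" "D' * D \<in> carrier_mat m m"
    using 1 2 by auto
  ultimately show ?thesis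
    unfolding column_equivalent_def by blast
qed

text \<open>A column addition is right multiplication by an elementary matrix, whose inverse is the
  one with the opposite scalar.\<close>

lemma column_equivalent_addcol:
  assumes "R \<in> carrier_mat r m" "C \<in> carrier_mat m m" "t < m" "j < m" "j \<noteq> t"
  shows "column_equivalent m (R, C) (addcol a t j R, addcol a t j C)"
proof -
  have "addcol a t j R = R * addrow_mat m a j t" "addcol a t j C = C * addrow_mat m a j t"
    using addcol_mat assms by blast+
  moreover have "addrow_mat m a j t * addrow_mat m (- a) j t = 1\<^sub>m m"
    using assms by (intro addrow_mat_inv) auto
  ultimately show ?thesis
    unfolding column_equivalent_def using addrow_mat_carrier by blast
qed

text \<open>The multiplier cancels the entry in row \<open>low R t\<close>. Below this row both
  columns are zero because their lowest entries lie in the same row, so no entry reappears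
  there.\<close>

lemma reduce_once_low_decreases:
  fixes R :: "'a::field mat"
  assumes "R \<in> carrier_mat r m" "t < m" "j < m" "j \<noteq> t" "cancels R S t j"
    and "R' = addcol (- (R $$ (low R t, t) / R $$ (low R t, j))) t j R"
  shows "zero_col R' t \<or> low R' t < low R t"
proof -
  note c = assms(5)[unfolded cancels_def]
  have t: "low R t < r" and j: "R $$ (low R t, j) \<noteq> 0"
    using low_nonzero[of t R] low_nonzero[of j R] assms c by auto
  have ent: "R' $$ (k, t) = R $$ (k, t) - R $$ (low R t, t) / R $$ (low R t, j) * R $$ (k, j)"
    if "k < r" for k
    using that assms by auto
  have "R' $$ (k, t) = 0" if "k < r" "low R t \<le> k" for k
    using ent[OF that(1)] j that below_low_zero[of k R t] below_low_zero[of k R j] assms c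
    by (cases "k = low R t") auto
  moreover have "low R' t < r \<and> R' $$ (low R' t, t) \<noteq> 0" if "\<not> zero_col R' t"
    using low_nonzero[of t R'] that assms by auto
  ultimately show ?thesis
    by (meson not_le)
qed

text \<open>Each pass lowers the position of the lowest entry of column \<open>t\<close>, so the
  loop terminates. \<open>S\<close> contains only indices below \<open>t\<close>, hence the added
  column differs from \<open>t\<close> and all other columns stay fixed.\<close>

lemma reduce_col_correct:
  fixes R C :: "'a::field mat"
  assumes "R \<in> carrier_mat r m" "C \<in> carrier_mat m m" "t < m" "S \<subseteq> {0..<t}"
    and "reduce_col S t (R, C) = (R', C')"
  shows "R' \<in> carrier_mat r m" "C' \<in> carrier_mat m m"
    and "column_equivalent m (R, C) (R', C')"
    and "\<And>u. u < m \<Longrightarrow> u \<noteq> t \<Longrightarrow> col R' u = col R u"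
    and "\<And>u. u < m \<Longrightarrow> u \<noteq> t \<Longrightarrow> col C' u = col C u"
    and "\<not> cancels R' S t j"
proof -
  define P where "P = (\<lambda>(R', C'). R' \<in> carrier_mat r m \<and> C' \<in> carrier_mat m m \<and>
    column_equivalent m (R, C) (R', C') \<and>
    (\<forall>u<m. u \<noteq> t \<longrightarrow> col R' u = col R u \<and> col C' u = col C u))"
  \<comment> \<open>\<open>low\<close> carries no information for a zero column, so that case has
    measure 0; the successor puts it strictly below a column whose lowest entry is in row 0.\<close>
  define \<mu> where "\<mu> = (\<lambda>(R' :: 'a mat, C' :: 'a mat). if zero_col R' t then 0 else Suc (low R' t))"
  have step: "P (reduce_once S t s) \<and> \<mu> (reduce_once S t s) < \<mu> s"
    if P: "P s" and c: "case s of (R, C) \<Rightarrow> \<exists>j. cancels R S t j" for s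
  proof -
    obtain R1 C1 where s: "s = (R1, C1)" by force
    define j where "j = (LEAST j. cancels R1 S t j)"
    have cj: "cancels R1 S t j"
      unfolding j_def using c s by (auto intro: LeastI)
    then have j: "j < m" "j \<noteq> t" using assms by (auto simp: cancels_def)
    define a where "a = - (R1 $$ (low R1 t, t) / R1 $$ (low R1 t, j))"
    have once: "reduce_once S t s = (addcol a t j R1, addcol a t j C1)"
      by (simp add: reduce_once_def s j_def a_def Let_def)
    have P1: "R1 \<in> carrier_mat r m" "C1 \<in> carrier_mat m m" "column_equivalent m (R, C) (R1, C1)"
      "\<And>u. u < m \<Longrightarrow> u \<noteq> t \<Longrightarrow> col R1 u = col R u \<and> col C1 u = col C u"
      using P by (auto simp: P_def s)
    have "column_equivalent m (R, C) (addcol a t j R1, addcol a t j C1)"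
      using column_equivalent_trans[OF assms(1,2) P1(3)]
        column_equivalent_addcol[OF P1(1,2) assms(3) j] by blast
    moreover have "col (addcol a t j X) u = col X u" if "u < m" "u \<noteq> t" "X \<in> carrier_mat k m" for u k and X :: "'a mat"
      by (rule eq_vecI) (use that in auto)
    ultimately have "P (reduce_once S t s)"
      using P1 unfolding once by (auto simp: P_def)
    moreover have "\<mu> (reduce_once S t s) < \<mu> s"
      using reduce_once_low_decreases[OF P1(1) assms(3) j cj, of "addcol a t j R1"] cj
      by (auto simp: once[unfolded s] s \<mu>_def a_def cancels_def)
    ultimately show ?thesis ..
  qed
  have "P (reduce_col S t (R, C)) \<and> \<not> (\<exists>j. cancels (fst (reduce_col S t (R, C))) S t j)"
    unfolding reduce_col_def
  proof (rule while_rule[where P = P and r = "measure \<mu>"])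
    show "P (R, C)" using assms column_equivalent_refl by (auto simp: P_def)
  qed (use step in auto)
  then show "R' \<in> carrier_mat r m" "C' \<in> carrier_mat m m" "column_equivalent m (R, C) (R', C')"
    "\<And>u. u < m \<Longrightarrow> u \<noteq> t \<Longrightarrow> col R' u = col R u" "\<And>u. u < m \<Longrightarrow> u \<noteq> t \<Longrightarrow> col C' u = col C u"
    "\<not> cancels R' S t j"
    using assms(5) by (auto simp: P_def)
qed

text \<open>Describes the state after the columns with index below \<open>k\<close> have been
  treated. The columns of \<open>C\<close> over \<open>I\<close> must not change: the vectors found
  in earlier rounds stand there and are already covered by the current list of basis
  vectors.\<close>

definition reduced_upto ::
  "nat \<Rightarrow> nat \<Rightarrow> nat set \<Rightarrow> 'a::field mat \<times> 'a mat \<Rightarrow> nat \<Rightarrow> 'a mat \<times> 'a mat \<times> nat set \<Rightarrow> bool" where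
  "reduced_upto r m I = (\<lambda>(R, C) k (R', C', I').
     R' \<in> carrier_mat r m \<and> C' \<in> carrier_mat m m \<and> column_equivalent m (R, C) (R', C') \<and>
     (\<forall>u\<in>I. col C' u = col C u) \<and> I' \<subseteq> {0..<k} - I \<and> (\<forall>u\<in>I \<union> I'. zero_col R' u) \<and>
     (\<forall>u\<in>{0..<k} - (I \<union> I'). \<not> zero_col R' u) \<and> inj_on (low R') ({0..<k} - (I \<union> I')))"

text \<open>Treating column \<open>k\<close> alters no other column, so earlier lowest entries
  persist. When column \<open>k\<close> stays non-zero, the exit condition of
  \<open>reduce_col\<close> says that its lowest entry lies in a row different from all of
  those.\<close>

lemma column_reduction_correct:
  fixes R C :: "'a::field mat"
  assumes R: "R \<in> carrier_mat r m" and C: "C \<in> carrier_mat m m" and I: "I \<subseteq> {0..<m}"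
    and z: "\<And>u. u \<in> I \<Longrightarrow> zero_col R u"
  shows "reduced_upto r m I (R, C) m (column_reduction R C I)"
proof -
  define F where "F = (\<lambda>t (R :: 'a mat, C :: 'a mat, I'). if t \<in> I then (R, C, I') else
        let (R', C') = reduce_col ({0..<t} - (I \<union> I')) t (R, C)
        in (R', C', if zero_col R' t then insert t I' else I'))"
  have "reduced_upto r m I (R, C) k (fold F [0..<k] (R, C, {}))" if "k \<le> m" for k
    using that
  proof (induction k)
    case 0
    then show ?case using assms column_equivalent_refl by (auto simp: reduced_upto_def)
  next
    case (Suc k)
    obtain R1 C1 I1 where s: "fold F [0..<k] (R, C, {}) = (R1, C1, I1)" by (metis prod_cases3)
    then have IH: "reduced_upto r m I (R, C) k (R1, C1, I1)" using Suc by simp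
    then have 1: "R1 \<in> carrier_mat r m" "C1 \<in> carrier_mat m m" "column_equivalent m (R, C) (R1, C1)"
      "\<And>u. u \<in> I \<Longrightarrow> col C1 u = col C u" "I1 \<subseteq> {0..<k} - I" "\<And>u. u \<in> I \<union> I1 \<Longrightarrow> zero_col R1 u"
      "\<And>u. u \<in> {0..<k} - (I \<union> I1) \<Longrightarrow> \<not> zero_col R1 u" "inj_on (low R1) ({0..<k} - (I \<union> I1))"
      by (auto simp: reduced_upto_def)
    have F: "fold F [0..<Suc k] (R, C, {}) = F k (R1, C1, I1)" by (simp add: s)
    show ?case
    proof (cases "k \<in> I")
      case True
      then have "{0..<Suc k} - (I \<union> I1) = {0..<k} - (I \<union> I1)" by (auto simp: less_Suc_eq)
      then show ?thesis using True IH unfolding F by (auto simp: F_def reduced_upto_def)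
    next
      case False
      let ?S = "{0..<k} - (I \<union> I1)"
      obtain R2 C2 where rc: "reduce_col ?S k (R1, C1) = (R2, C2)" by force
      have k: "k < m" using Suc by simp
      note 2 = reduce_col_correct[OF 1(1,2) k _ rc, simplified]
      have ce: "column_equivalent m (R, C) (R2, C2)"
        using column_equivalent_trans[OF R C 1(3) 2(3)] by blast
      have low: "low R2 u = low R1 u" "zero_col R2 u = zero_col R1 u" if "u < m" "u \<noteq> k" for u
        using col_eq_low_zero_col[of R2 R1 u] 1(1) 2(1) 2(4)[of u] that by auto
      have S: "u < m" "u \<noteq> k" if "u \<in> ?S" for u using that k by auto
      have inj: "inj_on (low R2) ?S" 
        using 1(8) low(1) S by (simp add: inj_on_def)
      have zero: "zero_col R2 u" if "u \<in> I \<union> I1" for u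
        using that 1(5) 1(6)[OF that] I False low(2)[of u] k by (cases "u = k") auto
      have nz: "\<not> zero_col R2 u" if "u \<in> ?S" for u
        using 1(7)[OF that] low(2)[of u] S[OF that] by simp
      have CI: "col C2 u = col C u" if "u \<in> I" for u
        using 2(5)[of u] 1(4)[OF that] that subsetD[OF I that] False by (cases "u = k") auto
      show ?thesis
      proof (cases "zero_col R2 k")
        case True
        have "{0..<Suc k} - (I \<union> insert k I1) = ?S" by auto
        then show ?thesis unfolding F
          using True False rc 1(5) 2(1,2) ce inj zero nz CI by (auto simp: F_def reduced_upto_def)
      next
        case nzk: False
        have eq: "{0..<Suc k} - (I \<union> I1) = insert k ?S" using False 1(5) by auto
        have "low R2 j \<noteq> low R2 k" if "j \<in> ?S" for j
          using 2(6)[of j] nzk that nz[OF that] by (auto simp: cancels_def)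
        then have "inj_on (low R2) (insert k ?S)" using inj by force
        moreover have "\<not> zero_col R2 u" if "u \<in> insert k ?S" for u using nz nzk that by blast
        moreover have "I1 \<subseteq> {0..<Suc k} - I" using 1(5) by auto
        ultimately show ?thesis unfolding F
          using nzk False rc 2(1,2) ce zero CI by (simp add: F_def reduced_upto_def eq)
      qed
    qed
  qed
  from this[of m] show ?thesis
    using R by (simp add: column_reduction_def F_def)
qed

text \<open>Among the non-zero columns with non-zero coefficient, take the one whose lowest entry is
  furthest down. In that row every other column contributes zero, so the product has a non-zero
  entry. Kernel vectors are thus supported on the zero columns.\<close>

lemma distinct_low_kernel:
  fixes R :: "'a::field mat"
  assumes R: "R \<in> carrier_mat r m" and y: "y \<in> carrier_vec m" and 0: "R *\<^sub>v y = 0\<^sub>v r"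
    and z: "\<And>u. u \<in> I \<Longrightarrow> zero_col R u" and nz: "\<And>u. u \<in> {0..<m} - I \<Longrightarrow> \<not> zero_col R u"
    and inj: "inj_on (low R) ({0..<m} - I)"
    and t: "t \<in> {0..<m} - I"
  shows "y $ t = 0"
proof (rule ccontr)
  assume yt: "y $ t \<noteq> 0"
  let ?T = "{u \<in> {0..<m} - I. y $ u \<noteq> 0}"
  define l where "l = Max (low R ` ?T)"
  have "l \<in> low R ` ?T" unfolding l_def using yt t by (intro Max_in) auto
  then obtain u where u: "u \<in> ?T" "low R u = l" by auto
  have ln: "l < r" "R $$ (l, u) \<noteq> 0"
    using low_nonzero[of u R] nz[of u] u R by auto
  have "R $$ (l, v) * y $ v = 0" if "v < m" "v \<noteq> u" for v
  proof (cases "v \<in> ?T")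
    case True
    then have "low R v \<le> l" unfolding l_def by (intro Max_ge) auto
    moreover have "low R v \<noteq> l" using inj True u that by (auto dest: inj_onD)
    ultimately show ?thesis using below_low_zero[of l R v] ln R by auto
  next
    case False
    then show ?thesis using z[of v] zero_col_iff[of v R] that ln R by auto
  qed
  then have "(\<Sum>v\<in>{0..<m}. R $$ (l, v) * y $ v) = (\<Sum>v\<in>{u}. R $$ (l, v) * y $ v)"
    using u by (intro sum.mono_neutral_right) auto
  moreover have "(R *\<^sub>v y) $ l = (\<Sum>v\<in>{0..<m}. R $$ (l, v) * y $ v)"
    using ln R y by (simp add: scalar_prod_def)
  ultimately show False using 0 ln u by simp
qed

section \<open>Basis completion and single step decomposition\<close>

lemma mult_unit_vec_eq_col:
  fixes C :: "'a::field mat"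
  assumes "C \<in> carrier_mat r m" "t < m"
  shows "C *\<^sub>v unit_vec m t = col C t"
  using assms by (intro eq_vecI) auto

lemma mult_mat_zero_vec:
  fixes C :: "'a::field mat"
  shows "C \<in> carrier_mat r m \<Longrightarrow> C *\<^sub>v 0\<^sub>v m = 0\<^sub>v r"
  by (intro eq_vecI) auto

section \<open>Spans, ranks and greedy basis completion\<close>

context vec_space
begin

lemma mult_mat_vec_in_span:
  assumes C: "C \<in> carrier_mat n m" and y: "y \<in> carrier_vec m" and S: "S \<subseteq> carrier_vec n"
    and cols: "\<And>t. t < m \<Longrightarrow> y $ t \<noteq> 0 \<Longrightarrow> col C t \<in> span S"
  shows "C *\<^sub>v y \<in> span S"
proof -
  \<comment> \<open>Columns with zero coefficient are replaced by zero, so the column space of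
    \<open>C'\<close> involves only the columns assumed to lie in the span.\<close>
  define C' where "C' = mat n m (\<lambda>(k, t). if y $ t = 0 then 0 else C $$ (k, t))"
  have C': "C' \<in> carrier_mat n m" by (simp add: C'_def)
  have "C *\<^sub>v y = C' *\<^sub>v y"
  proof (rule eq_vecI)
    fix k assume "k < dim_vec (C' *\<^sub>v y)"
    then show "(C *\<^sub>v y) $ k = (C' *\<^sub>v y) $ k"
      using C y by (auto simp: scalar_prod_def C'_def intro!: sum.cong)
  qed (use C C' in auto)
  also have "C' *\<^sub>v y \<in> span (set (cols C'))"
    using col_space_eq[OF C'] C' y unfolding col_space_def by auto
  also have "span (set (cols C')) \<subseteq> span S"
  proof (rule span_subsetI[OF S], rule subsetI)
    fix v assume "v \<in> set (cols C')"
    then obtain t where t: "t < m" "v = col C' t" using C' by (auto simp: cols_def)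
    show "v \<in> span S"
    proof (cases "y $ t = 0")
      case True
      then have "v = 0\<^sub>v n" using t by (auto simp: C'_def)
      then show ?thesis using span_is_submodule[of S] S by (simp add: submodule_def)
    next
      case False
      then have "v = col C t" using t C by (auto simp: C'_def)
      then show ?thesis using cols t False by simp
    qed
  qed
  finally show ?thesis .
qed

lemma list_rank_span_cong:
  assumes "set xs \<subseteq> carrier_vec n" "set ys \<subseteq> carrier_vec n" "span (set xs) = span (set ys)"
  shows "list_rank n xs = list_rank n ys"
  using assms by (simp add: list_rank_def rank_def)

lemma list_rank_lin_indpt:
  assumes "distinct xs" "set xs \<subseteq> carrier_vec n" "lin_indpt (set xs)"
  shows "list_rank n xs = length xs"
  unfolding list_rank_def
  using lin_indpt_full_rank[of "mat_of_cols n xs" "length xs"] assms by simp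

text \<open>For an independent list the rank test of \<open>bca\<close> is a test of span
  membership: inside the span the rank is unchanged, outside it the extended list is independent and
  longer.\<close>

lemma list_rank_less_append_iff:
  assumes "distinct xs" "set xs \<subseteq> carrier_vec n" "lin_indpt (set xs)" "w \<in> carrier_vec n"
  shows "list_rank n xs < list_rank n (xs @ [w]) \<longleftrightarrow> w \<notin> span (set xs)"
    and "w \<notin> span (set xs) \<Longrightarrow> distinct (xs @ [w]) \<and> lin_indpt (set (xs @ [w]))"
proof -
  have *: "distinct (xs @ [w]) \<and> lin_indpt (set (xs @ [w]))" if "w \<notin> span (set xs)"
  proof -
    have "w \<notin> set xs" using in_own_span[of "set xs"] assms that by auto
    then show ?thesis using lin_dep_iff_in_span[of "set xs" w] assms that by simp
  qed
  then show "w \<notin> span (set xs) \<Longrightarrow> distinct (xs @ [w]) \<and> lin_indpt (set (xs @ [w]))" .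
  show "list_rank n xs < list_rank n (xs @ [w]) \<longleftrightarrow> w \<notin> span (set xs)"
  proof (cases "w \<in> span (set xs)")
    case True
    then have "span (set xs) = span (set (xs @ [w]))"
      using already_in_span[of "set xs" w] assms by simp
    then show ?thesis using list_rank_span_cong[of xs "xs @ [w]"] assms True by simp
  next
    case False
    then show ?thesis
      using list_rank_lin_indpt[of xs] list_rank_lin_indpt[of "xs @ [w]"] *[OF False] assms by simp
  qed
qed

lemma bca_correct:
  assumes "distinct U" "set U \<subseteq> carrier_vec n" "lin_indpt (set U)" "set W \<subseteq> carrier_vec n"
  shows "distinct (U @ bca n U W)" "lin_indpt (set (U @ bca n U W))"
    and "set (bca n U W) \<subseteq> set W" "set W \<subseteq> span (set (U @ bca n U W))"
proof -
  define F where "F = (\<lambda>w (X :: 'a vec list, R). if list_rank n X < list_rank n (X @ [w]) then (X @ [w], R @ [w]) else (X, R))"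
  \<comment> \<open>Generalised over the accumulator: in every state of the fold the first component
    is \<open>U\<close> followed by the vectors accepted so far.\<close>
  have "\<exists>R'. fold F W (U @ R, R) = (U @ R', R') \<and> distinct (U @ R') \<and> lin_indpt (set (U @ R')) \<and>
     set R' \<subseteq> set R \<union> set W \<and> set (U @ R) \<subseteq> set (U @ R') \<and> set W \<subseteq> span (set (U @ R'))"
    if "distinct (U @ R)" "set R \<subseteq> carrier_vec n" "lin_indpt (set (U @ R))" "set W \<subseteq> carrier_vec n" for R
    using that
  proof (induction W arbitrary: R)
    case (Cons w W)
    have UR: "set (U @ R) \<subseteq> carrier_vec n" using Cons.prems assms by auto
    have w: "w \<in> carrier_vec n" "set W \<subseteq> carrier_vec n" using Cons.prems by auto
    note iff = list_rank_less_append_iff[OF Cons.prems(1) UR Cons.prems(3) w(1)]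
    define R1 where "R1 = (if w \<in> span (set (U @ R)) then R else R @ [w])"
    have F: "F w (U @ R, R) = (U @ R1, R1)"
      using iff(1) by (simp add: F_def R1_def)
    have R1: "distinct (U @ R1)" "lin_indpt (set (U @ R1))" "set R1 \<subseteq> carrier_vec n"
      using iff(2) Cons.prems w by (auto simp: R1_def)
    have UR1: "set (U @ R1) \<subseteq> carrier_vec n" using R1 assms by auto
    have wR1: "w \<in> span (set (U @ R1))"
    proof (cases "w \<in> span (set (U @ R))")
      case False
      then have "w \<in> set (U @ R1)" by (simp add: R1_def)
      then show ?thesis using in_own_span[of "set (U @ R1)"] UR1 by auto
    qed (simp add: R1_def)
    obtain R' where R': "fold F W (U @ R1, R1) = (U @ R', R')" "distinct (U @ R')" "lin_indpt (set (U @ R'))"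
      "set R' \<subseteq> set R1 \<union> set W" "set (U @ R1) \<subseteq> set (U @ R')" "set W \<subseteq> span (set (U @ R'))"
      using Cons.IH[OF R1(1,3,2) w(2)] by blast
    have "w \<in> span (set (U @ R'))"
      using span_is_monotone[OF R'(5)] wR1 by blast
    moreover have "set R1 \<subseteq> set R \<union> {w}" "set (U @ R) \<subseteq> set (U @ R1)" by (auto simp: R1_def)
    ultimately show ?case
      using R' F by (intro exI[of _ R']) auto
  qed auto
  from this[of "[]"] obtain R' where "fold F W (U, []) = (U @ R', R')" "distinct (U @ R')"
    "lin_indpt (set (U @ R'))" "set R' \<subseteq> set W" "set W \<subseteq> span (set (U @ R'))"
    using assms by auto
  moreover from this(1) have "bca n U W = R'" by (simp add: bca_def F_def)
  ultimately show "distinct (U @ bca n U W)" "lin_indpt (set (U @ bca n U W))"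
    "set (bca n U W) \<subseteq> set W" "set W \<subseteq> span (set (U @ bca n U W))" by auto
qed

end

section \<open>The loop of the single step decomposition and its invariant\<close>

primrec composite :: "(nat \<Rightarrow> 'a::field mat) \<Rightarrow> nat \<Rightarrow> nat \<Rightarrow> 'a mat" where
  "composite A i 0 = 1\<^sub>m (dim_col (A i))"
| "composite A i (Suc s) = A (i + s) * composite A i s"

text \<open>\<open>N\<close> is the length of the persistence module and \<open>d j\<close> the
  dimension of its space at \<open>j\<close>. The ambient vector space is the coordinate space at
  the fixed step \<open>i\<close>, and \<open>composite A i s\<close> is the matrix of the structure
  map from \<open>i\<close> to \<open>i + s\<close>.\<close>

locale ssd_run = vec_space f_ty m
  for f_ty :: "'a::field itself" and m :: nat +
  fixes N :: nat and d :: "nat \<Rightarrow> nat" and A :: "nat \<Rightarrow> 'a mat" and i :: nat and U :: "'a vec list"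
  assumes A: "j \<le> N \<Longrightarrow> A j \<in> carrier_mat (d (Suc j)) (d j)"
    and i: "1 \<le> i" "i \<le> N" and m: "d i = m"
    and U: "is_basis_list V ((\<lambda>x. A (i - 1) *\<^sub>v x) ` carrier_vec (dim_col (A (i - 1)))) U"
begin

abbreviation "P \<equiv> composite A i"

lemma P_carrier: "s \<le> N - i + 1 \<Longrightarrow> P s \<in> carrier_mat (d (i + s)) m"
proof (induction s)
  case 0
  then show ?case using A[of i] i m by auto
next
  case (Suc s)
  then show ?case using A[of "i + s"] i by (auto intro!: mult_carrier_mat)
qed

lemma dim_A: "dim_col (A i) = m"
  using A[of i] i m by auto

lemma P_kernel_Suc:
  assumes "s \<le> N - i" "v \<in> carrier_vec m" "P s *\<^sub>v v = 0\<^sub>v (d (i + s))"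
  shows "P (Suc s) *\<^sub>v v = 0\<^sub>v (d (i + Suc s))"
proof -
  have "A (i + s) \<in> carrier_mat (d (i + Suc s)) (d (i + s))" using A[of "i + s"] assms i by simp
  then show ?thesis using P_carrier[of s] assms mult_mat_zero_vec by simp
qed

lemma P_kernel_mono:
  assumes "s \<le> s'" "s' \<le> N - i + 1" "v \<in> carrier_vec m" "P s *\<^sub>v v = 0\<^sub>v (d (i + s))"
  shows "P s' *\<^sub>v v = 0\<^sub>v (d (i + s'))"
  using assms(1,2)
proof (induction s' rule: dec_induct)
  case (step k)
  then show ?case using P_kernel_Suc[of k v] assms by simp
qed (use assms in simp)

text \<open>Coordinate form of the \<open>kernel\<close> condition on generators at
  \<open>j = i + s\<close>, with the image of the preceding map expressed as the span of
  \<open>U\<close>.\<close>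

definition kernel_covered :: "'a vec list \<Rightarrow> nat \<Rightarrow> bool" where
  "kernel_covered B s \<longleftrightarrow> (\<forall>x\<in>carrier_vec m. P s *\<^sub>v x = 0\<^sub>v (d (i + s)) \<longrightarrow>
     x \<in> span (set U \<union> {v\<in>set B. P s *\<^sub>v v = 0\<^sub>v (d (i + s))}))"

lemma kernel_covered_mono:
  assumes "kernel_covered B s" "set B \<subseteq> set B'"
  shows "kernel_covered B' s"
proof -
  have "span (set U \<union> {v\<in>set B. P s *\<^sub>v v = 0\<^sub>v (d (i + s))}) \<subseteq>
    span (set U \<union> {v\<in>set B'. P s *\<^sub>v v = 0\<^sub>v (d (i + s))})"
    using assms by (intro span_is_monotone) auto
  then show ?thesis using assms unfolding kernel_covered_def by blast
qed

text \<open>The form met inside the loop: all vectors collected so far are dead at the current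
  \<open>s\<close>, so the filter in \<open>kernel_covered\<close> keeps all of them.\<close>

lemma kernel_coveredI:
  assumes "\<And>v. v \<in> set B \<Longrightarrow> P s *\<^sub>v v = 0\<^sub>v (d (i + s))"
    and "\<And>x. x \<in> carrier_vec m \<Longrightarrow> P s *\<^sub>v x = 0\<^sub>v (d (i + s)) \<Longrightarrow> x \<in> span (set (U @ B))"
  shows "kernel_covered B s"
proof -
  have "{v\<in>set B. P s *\<^sub>v v = 0\<^sub>v (d (i + s))} = set B" using assms by auto
  then show ?thesis using assms by (simp add: kernel_covered_def)
qed

lemma U_basis: "distinct U" "set U \<subseteq> carrier_vec m" "lin_indpt (set U)"
  "span (set U) = (\<lambda>x. A (i - 1) *\<^sub>v x) ` carrier_vec (dim_col (A (i - 1)))"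
  using U by (auto simp: is_basis_list_def)

lemma A_pred: "A (i - 1) \<in> carrier_mat m (d (i - 1))"
  using A[of "i - 1"] i m by simp

text \<open>Identifies the number \<open>k\<close> of the algorithm with the length of the initial
  list, so its second stopping test says that the collected independent list has \<open>m\<close>
  elements.\<close>

lemma rank_eq_length_U: "rank (A (i - 1)) = length U"
proof -
  have "set (cols (A (i - 1))) \<subseteq> carrier_vec m" by (metis cols_dim carrier_matD(1) A_pred)
  moreover have "span (set (cols (A (i - 1)))) = span (set U)"
    using col_space_eq[OF A_pred] A_pred unfolding U_basis(4) col_space_def by auto
  ultimately have "rank (A (i - 1)) = list_rank m U"
    using U_basis by (simp add: list_rank_def rank_def)
  then show ?thesis using list_rank_lin_indpt U_basis by simp
qed

text \<open>Here \<open>s\<close> counts completed iterations, so \<open>R\<close> stands for the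
  composite of \<open>s\<close> maps. The value 0 is left out of the covered range because
  \<open>P 0\<close> is the identity. Once the loop has stopped, \<open>R\<close> and
  \<open>C\<close> are frozen and their clauses lapse; in exchange all remaining kernels must be
  covered already.\<close>

definition run_inv :: "nat \<Rightarrow> 'a ssd_state \<Rightarrow> bool" where
  "run_inv s st \<longleftrightarrow>
     st_U st = U @ st_birth st \<and> distinct (st_U st) \<and> lin_indpt (set (st_U st)) \<and>
     set (st_U st) \<subseteq> carrier_vec m \<and> (\<forall>s'\<in>{1..s}. kernel_covered (st_birth st) s') \<and>
     (st_stop st \<longrightarrow> (\<forall>s'\<in>{s..N - i + 1}. kernel_covered (st_birth st) s')) \<and>
     (\<not> st_stop st \<longrightarrow> 
       st_C st \<in> carrier_mat m m \<and> st_R st = P s * st_C st \<and> (\<exists>D\<in>carrier_mat m m. st_C st * D = 1\<^sub>m m) \<and>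
       st_inds st \<subseteq> {0..<m} \<and> st_r st = m - card (st_inds st) \<and>
       (\<forall>u\<in>st_inds st. zero_col (st_R st) u \<and> col (st_C st) u \<in> span (set (st_U st))) \<and>
       (\<forall>v\<in>set (st_birth st). P s *\<^sub>v v = 0\<^sub>v (d (i + s))))"

text \<open>For \<open>x\<close> in the kernel of \<open>P (Suc s)\<close>, its coordinates with
  respect to the columns of \<open>C'\<close> form a kernel vector of the reduced \<open>R'\<close>,
  hence are supported on the zero columns. The columns of \<open>C'\<close> there lie in the
  extended span, either from earlier rounds or by basis completion.\<close>

lemma run_inv_step:
  assumes inv: "run_inv s st" and ns: "\<not> st_stop st" and s: "s \<le> N - i"
  shows "run_inv (Suc s) (ssd_step A i s st)"
proof -
  let ?I = "st_inds st" and ?C = "st_C st" and ?R = "A (i + s) * st_R st"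
  let ?r = "d (i + Suc s)"
  have U: "st_U st = U @ st_birth st" "distinct (st_U st)" "lin_indpt (set (st_U st))"
      "set (st_U st) \<subseteq> carrier_vec m" "\<And>s'. s' \<in> {1..s} \<Longrightarrow> kernel_covered (st_birth st) s'"
    and C: "?C \<in> carrier_mat m m" and R: "st_R st = P s * ?C"
    and I: "?I \<subseteq> {0..<m}" "st_r st = m - card ?I"
      "\<And>u. u \<in> ?I \<Longrightarrow> zero_col (st_R st) u" "\<And>u. u \<in> ?I \<Longrightarrow> col ?C u \<in> span (set (st_U st))"
    and births: "\<And>v. v \<in> set (st_birth st) \<Longrightarrow> P s *\<^sub>v v = 0\<^sub>v (d (i + s))"
    using inv ns by (auto simp: run_inv_def)
  obtain D where D: "D \<in> carrier_mat m m" "?C * D = 1\<^sub>m m"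
    using inv ns by (auto simp: run_inv_def)
  have As: "A (i + s) \<in> carrier_mat ?r (d (i + s))" using A[of "i + s"] s i by simp
  have Ps: "P s \<in> carrier_mat (d (i + s)) m" and PS: "P (Suc s) \<in> carrier_mat ?r m"
    using P_carrier[of s] P_carrier[of "Suc s"] s by auto
  have Rc: "?R \<in> carrier_mat ?r m" using R As Ps C by auto
  have R1: "?R = P (Suc s) * ?C"
    using R As Ps C by (simp add: assoc_mult_mat[of _ _ "d (i + s)"])
  have zR: "zero_col ?R u" if "u \<in> ?I" for u
  proof -
    have "u < m" using I that by auto
    then have "col ?R u = A (i + s) *\<^sub>v col (st_R st) u"
      using R As Ps C by (intro col_mult2[of _ _ "d (i + s)" _ m]) auto
    moreover have "col (st_R st) u = 0\<^sub>v (d (i + s))"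
      using I(3)[OF that] R Ps by (simp add: zero_col_def)
    ultimately show ?thesis using As mult_mat_zero_vec by (simp add: zero_col_def)
  qed
  obtain R' C' I' where cr: "column_reduction ?R ?C ?I = (R', C', I')" by (metis prod_cases3)
  have red: "R' \<in> carrier_mat ?r m" "C' \<in> carrier_mat m m" "column_equivalent m (?R, ?C) (R', C')"
    "\<And>u. u \<in> ?I \<Longrightarrow> col C' u = col ?C u" "I' \<subseteq> {0..<m} - ?I" "\<And>u. u \<in> ?I \<union> I' \<Longrightarrow> zero_col R' u"
    "\<And>u. u \<in> {0..<m} - (?I \<union> I') \<Longrightarrow> \<not> zero_col R' u" "inj_on (low R') ({0..<m} - (?I \<union> I'))"
    using column_reduction_correct[OF Rc C I(1) zR] cr by (auto simp: reduced_upto_def)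
  obtain E D' where E: "E \<in> carrier_mat m m" "D' \<in> carrier_mat m m" "E * D' = 1\<^sub>m m"
    "R' = ?R * E" "C' = ?C * E"
    using red(3) by (auto simp: column_equivalent_def)
  have R': "R' = P (Suc s) * C'"
    using E R1 PS C by (simp add: assoc_mult_mat[of _ ?r m _ m _ m])
  have "E * (D' * D) = D"
    using E D by (simp flip: assoc_mult_mat[of _ m m _ m _ m])
  then have D2: "C' * (D' * D) = 1\<^sub>m m" "D' * D \<in> carrier_mat m m"
    using E D C by (simp_all add: assoc_mult_mat[of _ m m _ m _ m])
  have fin: "finite I'" "finite ?I" using red(5) I(1) by (auto intro: finite_subset)
  define B where "B = map (\<lambda>t. C' *\<^sub>v unit_vec m t) (sorted_list_of_set I')"
  have B: "set B = col C' ` I'"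
  proof -
    have "set B = (\<lambda>t. C' *\<^sub>v unit_vec m t) ` I'" using fin by (simp add: B_def)
    also have "\<dots> = col C' ` I'"
      using red(2,5) by (intro image_cong refl mult_unit_vec_eq_col) auto
    finally show ?thesis .
  qed
  have Bc: "set B \<subseteq> carrier_vec m" using B red(2) by auto
  define Bn where "Bn = bca m (st_U st) B"
  note bca = bca_correct[OF U(2,4,3) Bc, folded Bn_def]
  let ?U = "st_U st @ Bn"
  have Uc: "set ?U \<subseteq> carrier_vec m" using U(4) bca(3) Bc by auto
  define st' where "st' = ssd_step A i s st"
  have cardI: "card (?I \<union> I') = card ?I + card I'" "card (?I \<union> I') \<le> m"
    using fin red(5) card_mono[of "{0..<m}" "?I \<union> I'"] I(1) by (auto intro!: card_Un_disjoint)
  \<comment> \<open>One description serves both branches of \<open>ssd_step\<close>: without new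
    zero columns, \<open>Bn\<close> is empty and the skipped updates would change nothing.\<close>
  have "st_R st' = R' \<and> st_C st' = C' \<and> st_r st' = m - card (?I \<union> I') \<and> st_inds st' = ?I \<union> I' \<and>
    st_U st' = ?U \<and> st_birth st' = st_birth st @ Bn \<and>
    (st_stop st' \<longleftrightarrow> m - card (?I \<union> I') = 0 \<or> length (st_birth st @ Bn) + length U = m)"
  proof (cases "I' = {}")
    case True
    then have "Bn = []" by (simp add: Bn_def B_def bca_def)
    then show ?thesis
      using True I(2) rank_eq_length_U
      by (simp add: st'_def ssd_step_def dim_A cr Let_def)
  next
    case False
    then have "card I' > 0" using fin by (simp add: card_gt_0_iff)
    then have "st_r st - card I' < st_r st" "st_r st - card I' = m - card (?I \<union> I')"
      using cardI I(2) by auto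
    then show ?thesis
      using rank_eq_length_U
      by (simp add: st'_def ssd_step_def dim_A cr Let_def B_def Bn_def)
  qed
  then have st': "st_R st' = R'" "st_C st' = C'" "st_r st' = m - card (?I \<union> I')"
    "st_inds st' = ?I \<union> I'" "st_U st' = ?U" "st_birth st' = st_birth st @ Bn"
    "st_stop st' \<longleftrightarrow> m - card (?I \<union> I') = 0 \<or> length (st_birth st @ Bn) + length U = m" by auto
  have sub: "span (set (st_U st)) \<subseteq> span (set ?U)" by (rule span_is_monotone) auto
  have colU: "col C' u \<in> span (set ?U)" if "u \<in> ?I \<union> I'" for u
  proof (cases "u \<in> ?I")
    case True
    then show ?thesis using I(4) red(4) sub by auto
  next
    case False
    then show ?thesis using bca(4) B that by auto
  qed
  have inv': "C' *\<^sub>v ((D' * D) *\<^sub>v x) = x" if "x \<in> carrier_vec m" for x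
    using assoc_mult_mat_vec[OF red(2) D2(2) that] D2 that by simp
  have ker: "x \<in> span (set ?U)" if x: "x \<in> carrier_vec m" "P (Suc s) *\<^sub>v x = 0\<^sub>v ?r" for x
  proof -
    let ?y = "(D' * D) *\<^sub>v x"
    have y: "?y \<in> carrier_vec m" using D2 x by simp
    have "R' *\<^sub>v ?y = 0\<^sub>v ?r"
      unfolding R' using assoc_mult_mat_vec[OF PS red(2) y] inv'[OF x(1)] x(2) by simp
    then have "?y $ t = 0" if "t \<in> {0..<m} - (?I \<union> I')" for t
      using distinct_low_kernel[OF red(1) y _ _ _ red(8) that] red(6,7) by blast
    then have "C' *\<^sub>v ?y \<in> span (set ?U)"
      using colU by (intro mult_mat_vec_in_span[OF red(2) y Uc]) (metis Diff_iff atLeastLessThan_iff zero_le)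
    then show ?thesis using inv'[OF x(1)] by simp
  qed
  have births': "P (Suc s) *\<^sub>v v = 0\<^sub>v ?r" if "v \<in> set (st_birth st @ Bn)" for v
  proof (cases "v \<in> set (st_birth st)")
    case True
    then show ?thesis using P_kernel_Suc[OF s _ births] U by auto
  next
    case False
    then have "v \<in> set Bn" using that by simp
    then obtain t where t: "t \<in> I'" "v = col C' t" using bca(3) B by blast
    then have "P (Suc s) *\<^sub>v v = col R' t"
      unfolding R' using red(2,5) PS by (auto intro!: col_mult2[symmetric])
    then show ?thesis using red(1) red(6)[of t] t by (simp add: zero_col_def)
  qed
  have U': "?U = U @ (st_birth st @ Bn)" using U by simp
  have covS: "kernel_covered (st_birth st @ Bn) (Suc s)"
    using ker births' by (intro kernel_coveredI) (simp_all add: U')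
  \<comment> \<open>Either stopping test makes the collected list span everything: with no non-zero
    column left, all columns of \<open>C'\<close> lie in its span; with \<open>m\<close> independent
    vectors, it is a basis.\<close>
  have full: "x \<in> span (set ?U)" if "st_stop st'" "x \<in> carrier_vec m" for x
    using st'(7)[THEN iffD1, OF that(1)]
  proof
    assume "m - card (?I \<union> I') = 0"
    then have "?I \<union> I' = {0..<m}"
      using cardI I(1) red(5) by (intro card_subset_eq) auto
    then have "C' *\<^sub>v ((D' * D) *\<^sub>v x) \<in> span (set ?U)"
      using colU D2 that by (intro mult_mat_vec_in_span[OF red(2) _ Uc]) auto
    then show ?thesis using inv' that by simp
  next
    assume "length (st_birth st @ Bn) + length U = m"
    then have "card (set ?U) = m"
      using distinct_card[OF bca(1)] U(1) by simp
    then have "basis (set ?U)"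
      using bca(2) Uc dim_is_n by (intro dim_li_is_basis) auto
    then show ?thesis using that by (simp add: basis_def)
  qed
  \<comment> \<open>Vectors dead at \<open>Suc s\<close> stay dead later, so spanning the whole
    space settles all remaining kernels at once.\<close>
  have stop: "kernel_covered (st_birth st @ Bn) s'" if "st_stop st'" "s' \<in> {Suc s..N - i + 1}" for s'
  proof (rule kernel_coveredI)
    fix v assume "v \<in> set (st_birth st @ Bn)"
    then show "P s' *\<^sub>v v = 0\<^sub>v (d (i + s'))"
      using births'[of v] Uc U' that P_kernel_mono[of "Suc s" s' v] by auto
  qed (use full that U' in simp)
  have cov: "kernel_covered (st_birth st @ Bn) s'" if "s' \<in> {1..Suc s}" for s'
    using kernel_covered_mono[OF U(5)[of s'], of "st_birth st @ Bn"] covS that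
    by (cases "s' = Suc s") auto
  show ?thesis
    unfolding st'_def[symmetric] run_inv_def st'
    using U' bca(1,2) Uc stop cov red(1,2,5,6) R' D2 I(1) colU births' by (auto simp: st'(7))
qed

text \<open>The fold makes \<open>N - i + 1\<close> passes, and the invariant after the last one
  covers every kernel up to that of the map into the space with index \<open>N + 1\<close>. After an
  early stop the invariant advances through its clause for stopped states.\<close>

lemma ssd_correct:
  fixes B
  defines "B \<equiv> fst (ssd N A U i)"
  shows "distinct (U @ B)" "lin_indpt (set (U @ B))" "set B \<subseteq> carrier_vec m"
    and "s \<in> {1..N - i + 1} \<Longrightarrow> kernel_covered B s"
proof -
  define st0 where "st0 = \<lparr>st_R = 1\<^sub>m m, st_C = 1\<^sub>m m, st_r = m, st_inds = {}, st_U = U,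
             st_birth = [], st_J = (\<lambda>_. 0), st_stop = False\<rparr>"
  define F where "F = (\<lambda>s st. if st_stop st then st else ssd_step A i s st)"
  have "run_inv s (fold F [0..<s] st0)" if "s \<le> N - i + 1" for s
    using that
  proof (induction s)
    case 0
    then show ?case
      using U_basis dim_A by (auto simp: run_inv_def st0_def intro!: bexI[of _ "1\<^sub>m m"])
  next
    case (Suc s)
    let ?st = "fold F [0..<s] st0"
    have IH: "run_inv s ?st" using Suc by simp
    show ?case
    proof (cases "st_stop ?st")
      case True
      then have "run_inv (Suc s) ?st"
        using IH Suc.prems unfolding run_inv_def by (auto simp: le_Suc_eq)
      then show ?thesis using True by (simp add: F_def)
    next
      case False
      then show ?thesis using run_inv_step[OF IH False] Suc.prems by (simp add: F_def)
    qed
  qed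
  from this[of "N - i + 1"] have inv: "run_inv (N - i + 1) (fold F [0..<N - i + 1] st0)" by simp
  have "B = st_birth (fold F [0..<N - i + 1] st0)"
    by (simp add: B_def ssd_def Let_def dim_A F_def st0_def)
  then show "distinct (U @ B)" "lin_indpt (set (U @ B))" "set B \<subseteq> carrier_vec m"
    "s \<in> {1..N - i + 1} \<Longrightarrow> kernel_covered B s"
    using inv by (auto simp: run_inv_def)
qed

end

section \<open>Transfer along coordinates\<close>

lemma mult_mat_vec_eq_finsum:
  fixes C :: "'a::field mat"
  assumes C: "C \<in> carrier_mat r m" and x: "x \<in> carrier_vec m"
  shows "C *\<^sub>v x = finsum (module_vec TYPE('a) r) (\<lambda>t. x $ t \<cdot>\<^sub>v col C t) {..<m}"
proof -
  interpret vec_space "TYPE('a)" r .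
  have cl: "(\<lambda>t. x $ t \<cdot>\<^sub>v col C t) \<in> {..<m} \<rightarrow> carrier_vec r" using C by auto
  show ?thesis
  proof (rule eq_vecI)
    fix k assume "k < dim_vec (finsum V (\<lambda>t. x $ t \<cdot>\<^sub>v col C t) {..<m})"
    then have k: "k < r" using carrier_vecD[OF M.finsum_closed[OF cl]] by simp
    have "finsum_vec TYPE('a) r (\<lambda>t. x $ t \<cdot>\<^sub>v col C t) {..<m} $ k = (\<Sum>t<m. (x $ t \<cdot>\<^sub>v col C t) $ k)"
      by (rule index_finsum_vec) (use k cl in auto)
    then show "(C *\<^sub>v x) $ k = finsum V (\<lambda>t. x $ t \<cdot>\<^sub>v col C t) {..<m} $ k"
      using k C x by (auto simp: scalar_prod_def lessThan_atLeast0 intro!: sum.cong)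
  next
    show "dim_vec (C *\<^sub>v x) = dim_vec (finsum V (\<lambda>t. x $ t \<cdot>\<^sub>v col C t) {..<m})"
      using C carrier_vecD[OF M.finsum_closed[OF cl]] by (metis carrier_matD(1) dim_mult_mat_vec)
  qed
qed

text \<open>Linear independence makes the coordinate map injective, and spanning makes it
  surjective.\<close>

lemma basis_list_coordinates:
  fixes W :: "('a::field, 'b, 'm) module_scheme"
  assumes vs: "vectorspace class_ring W" and xs: "is_basis_list W (carrier W) xs"
  defines "T \<equiv> \<lambda>x. finsum W (\<lambda>j. x $ j \<odot>\<^bsub>W\<^esub> (xs ! j)) {..<length xs}"
  shows "linear_map class_ring (module_vec TYPE('a) (length xs)) W T"
    and "bij_betw T (carrier_vec (length xs)) (carrier W)"
proof -
  interpret W: vectorspace class_ring W by (rule vs)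
  let ?m = "length xs"
  have d: "distinct xs" "set xs \<subseteq> carrier W" "W.lin_indpt (set xs)" "W.span (set xs) = carrier W"
    using xs by (auto simp: is_basis_list_def)
  have nth: "xs ! j \<in> carrier W" if "j < ?m" for j using d that by auto
  have sm: "a \<odot>\<^bsub>W\<^esub> xs ! j \<in> carrier W" if "j < ?m" for a j
    using W.smult_closed[of a "xs ! j"] nth[OF that] by (simp add: class_ring_simps)
  have cl: "T x \<in> carrier W" for x
    unfolding T_def by (rule W.module.M.finsum_closed) (use sm in auto)
  have add: "T (x + y) = T x \<oplus>\<^bsub>W\<^esub> T y" if "x \<in> carrier_vec ?m" "y \<in> carrier_vec ?m" for x y
    unfolding T_def
  proof (subst W.module.M.finsum_addf[symmetric])
    show "(\<Oplus>\<^bsub>W\<^esub>j\<in>{..<?m}. (x + y) $ j \<odot>\<^bsub>W\<^esub> xs ! j) =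
      (\<Oplus>\<^bsub>W\<^esub>j\<in>{..<?m}. x $ j \<odot>\<^bsub>W\<^esub> xs ! j \<oplus>\<^bsub>W\<^esub> y $ j \<odot>\<^bsub>W\<^esub> xs ! j)"
    proof (rule W.module.M.finsum_cong')
      fix j assume "j \<in> {..<?m}"
      then show "(x + y) $ j \<odot>\<^bsub>W\<^esub> xs ! j = x $ j \<odot>\<^bsub>W\<^esub> xs ! j \<oplus>\<^bsub>W\<^esub> y $ j \<odot>\<^bsub>W\<^esub> xs ! j"
        using W.smult_l_distr[of "x $ j" "y $ j" "xs ! j"] nth that by (simp add: class_ring_simps)
    qed (use sm in auto)
  qed (use sm in auto)
  have smult: "T (a \<cdot>\<^sub>v x) = a \<odot>\<^bsub>W\<^esub> T x" if "x \<in> carrier_vec ?m" for a x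
    unfolding T_def
  proof (subst W.finsum_smult)
    show "(\<Oplus>\<^bsub>W\<^esub>j\<in>{..<?m}. (a \<cdot>\<^sub>v x) $ j \<odot>\<^bsub>W\<^esub> xs ! j) =
      (\<Oplus>\<^bsub>W\<^esub>j\<in>{..<?m}. a \<odot>\<^bsub>W\<^esub> (x $ j \<odot>\<^bsub>W\<^esub> xs ! j))"
    proof (rule W.module.M.finsum_cong')
      fix j assume "j \<in> {..<?m}"
      then show "(a \<cdot>\<^sub>v x) $ j \<odot>\<^bsub>W\<^esub> xs ! j = a \<odot>\<^bsub>W\<^esub> (x $ j \<odot>\<^bsub>W\<^esub> xs ! j)"
        using W.smult_assoc1[of a "x $ j" "xs ! j"] nth that by (simp add: class_ring_simps)
    next
      show "(\<lambda>j. a \<odot>\<^bsub>W\<^esub> (x $ j \<odot>\<^bsub>W\<^esub> xs ! j)) \<in> {..<?m} \<rightarrow> carrier W"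
        using sm W.smult_closed[of a] by (auto simp: class_ring_simps)
    qed simp
  qed (use sm in \<open>auto simp: class_ring_simps\<close>)
  show lin: "linear_map class_ring (module_vec TYPE('a) ?m) W T"
    by (rule linear_mapI[OF vec_vs vs])
      (use cl add smult in \<open>auto simp: LinearCombinations.module_hom_def module_vec_simps\<close>)
  interpret L: linear_map class_ring "module_vec TYPE('a) ?m" W T by (rule lin)
  have inj: "inj_on (nth xs) {..<?m}" using d by (simp add: inj_on_nth)
  have im: "nth xs ` {..<?m} = set xs" by (auto simp: in_set_conv_nth)
  have lc: "T x = W.lincomb a (set xs)" if "\<And>j. j < ?m \<Longrightarrow> a (xs ! j) = x $ j" for a x
  proof -
    have "finsum W (\<lambda>v. a v \<odot>\<^bsub>W\<^esub> v) (nth xs ` {..<?m}) = finsum W (\<lambda>j. a (xs ! j) \<odot>\<^bsub>W\<^esub> xs ! j) {..<?m}"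
      by (rule W.module.M.finsum_reindex) (use inj sm in auto)
    also have "\<dots> = T x"
      unfolding T_def by (rule W.module.M.finsum_cong') (use that sm in auto)
    finally show ?thesis by (simp add: W.lincomb_def im)
  qed
  have "x = 0\<^sub>v ?m" if x: "x \<in> carrier_vec ?m" "T x = \<zero>\<^bsub>W\<^esub>" for x
  proof -
    \<comment> \<open>\<open>lincomb\<close> takes coefficients indexed by vectors, whereas
      \<open>x\<close> is indexed by positions; distinctness of the list allows the position to be
      recovered.\<close>
    define a where "a = (\<lambda>v. x $ the_inv_into {..<?m} (nth xs) v)"
    have a: "a (xs ! j) = x $ j" if "j < ?m" for j
      using that by (simp add: a_def the_inv_into_f_f[OF inj])
    then have "W.lincomb a (set xs) = \<zero>\<^bsub>W\<^esub>" using lc[of a x] x by simp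
    then have a0: "a \<in> set xs \<rightarrow> {\<zero>\<^bsub>class_ring\<^esub>}"
      by (intro W.not_lindepD[OF d(3)]) (auto simp: class_ring_simps)
    have "x $ j = 0" if "j < ?m" for j
      using funcset_mem[OF a0 nth_mem[OF that]] a[OF that] by (simp add: class_ring_simps)
    then show ?thesis using x by (intro eq_vecI) auto
  qed
  then have "L.kerT = {\<zero>\<^bsub>module_vec TYPE('a) ?m\<^esub>}"
    using L.f0_is_0 by (auto simp: L.ker_def module_vec_simps)
  then have "inj_on T (carrier_vec ?m)"
    using L.Ke0_imp_inj by (simp add: module_vec_simps)
  moreover have "T ` carrier_vec ?m = carrier W"
  proof
    show "carrier W \<subseteq> T ` carrier_vec ?m"
    proof
      fix w assume "w \<in> carrier W"
      then obtain a where "w = W.lincomb a (set xs)"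
        using W.finite_in_span[of "set xs" w] d by auto
      then have "w = T (vec ?m (\<lambda>j. a (xs ! j)))" using lc[of a "vec ?m (\<lambda>j. a (xs ! j))"] by simp
      then show "w \<in> T ` carrier_vec ?m" by auto
    qed
  qed (use cl in auto)
  ultimately show "bij_betw T (carrier_vec ?m) (carrier W)" by (simp add: bij_betw_def)
qed

section \<open>The algorithm run on a persistence module given by matrices\<close>

locale presented_persistence = persistence n M \<phi>
  for n and M :: "nat \<Rightarrow> ('a::field, 'b, 'm) module_scheme" and \<phi> +
  fixes bs :: "nat \<Rightarrow> 'b list" and A :: "nat \<Rightarrow> 'a mat" and U :: "nat \<Rightarrow> 'a vec list"
  assumes pres: "matrix_presentation n M \<phi> bs A" and img: "image_basis_choice n A U"
begin

abbreviation "d i \<equiv> length (bs i)"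
abbreviation "T \<equiv> from_coords M bs"

lemma A_carrier: "i \<le> n \<Longrightarrow> A i \<in> carrier_mat (d (Suc i)) (d i)"
  using pres by (simp add: matrix_presentation_def)

lemma T_linear: "i \<le> n + 1 \<Longrightarrow> linear_map class_ring (module_vec TYPE('a) (d i)) (M i) (T i)"
  and T_bij: "i \<le> n + 1 \<Longrightarrow> bij_betw (T i) (carrier_vec (d i)) (carrier (M i))"
  using basis_list_coordinates[OF vs, of i "bs i"] pres
  by (simp_all add: matrix_presentation_def from_coords_def[abs_def])

lemma T_surj: "i \<le> n + 1 \<Longrightarrow> w \<in> carrier (M i) \<Longrightarrow> \<exists>x\<in>carrier_vec (d i). w = T i x"
  using bij_betw_imp_surj_on[OF T_bij, of i] by blast

lemma T_closed: "i \<le> n + 1 \<Longrightarrow> x \<in> carrier_vec (d i) \<Longrightarrow> T i x \<in> carrier (M i)"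
  using T_bij by (blast dest: bij_betwE)

lemma T_zero: "i \<le> n + 1 \<Longrightarrow> T i (0\<^sub>v (d i)) = \<zero>\<^bsub>M i\<^esub>"
  using mod_hom.f0_is_0[OF linear_map.axioms(3)[OF T_linear, of i]] by (simp add: module_vec_simps)

lemma T_eq_zeroD:
  assumes "i \<le> n + 1" "x \<in> carrier_vec (d i)" "T i x = \<zero>\<^bsub>M i\<^esub>"
  shows "x = 0\<^sub>v (d i)"
  by (rule inj_onD[OF bij_betw_imp_inj_on[OF T_bij[OF assms(1)]]]) (use assms T_zero in simp_all)

text \<open>Both sides are linear in \<open>x\<close>, and on the basis vectors the equation is the
  definition of a matrix presentation.\<close>

lemma phi_T:
  assumes "i \<le> n" "x \<in> carrier_vec (d i)"
  shows "\<phi> i (T i x) = T (Suc i) (A i *\<^sub>v x)"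
proof -
  interpret L: linear_map class_ring "M i" "M (Suc i)" "\<phi> i" using lm[of i] assms by simp
  interpret S: linear_map class_ring "module_vec TYPE('a) (d (Suc i))" "M (Suc i)" "T (Suc i)"
    by (rule T_linear) (use assms in simp)
  have b: "bs i ! j \<in> carrier (M i)" if "j < d i" for j
  proof -
    have "is_basis_list (M i) (carrier (M i)) (bs i)"
      using pres assms by (simp add: matrix_presentation_def)
    then show ?thesis using nth_mem[OF that] by (auto simp: is_basis_list_def)
  qed
  have bj: "x $ j \<odot>\<^bsub>M i\<^esub> bs i ! j \<in> carrier (M i)" if "j < d i" for j
    using b[OF that] L.V.module.smult_closed[of "x $ j"] by (simp add: class_ring_simps)
  have c: "col (A i) j \<in> carrier_vec (d (Suc i))" for j
    using A_carrier[of i] assms by (intro carrier_vecI) simp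
  have "\<phi> i (T i x) = finsum (M (Suc i)) (\<lambda>j. \<phi> i (x $ j \<odot>\<^bsub>M i\<^esub> bs i ! j)) {..<d i}"
    unfolding from_coords_def by (rule L.map_finsum) (use bj in auto)
  also have "\<dots> = finsum (M (Suc i)) (\<lambda>j. T (Suc i) (x $ j \<cdot>\<^sub>v col (A i) j)) {..<d i}"
  proof (rule L.W.module.M.finsum_cong')
    fix j assume j: "j \<in> {..<d i}"
    then have "\<phi> i (bs i ! j) = T (Suc i) (col (A i) j)"
      using pres assms by (simp add: matrix_presentation_def)
    then show "\<phi> i (x $ j \<odot>\<^bsub>M i\<^esub> bs i ! j) = T (Suc i) (x $ j \<cdot>\<^sub>v col (A i) j)"
      using b j c S.f_smult[of "x $ j" "col (A i) j"] by (simp add: class_ring_simps module_vec_simps)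
  qed (use T_closed c assms in auto)
  also have "\<dots> = T (Suc i) (finsum (module_vec TYPE('a) (d (Suc i))) (\<lambda>j. x $ j \<cdot>\<^sub>v col (A i) j) {..<d i})"
    by (rule S.map_finsum[symmetric]) (use c in \<open>auto simp: module_vec_simps\<close>)
  also have "\<dots> = T (Suc i) (A i *\<^sub>v x)"
    using mult_mat_vec_eq_finsum[OF A_carrier] assms by simp
  finally show ?thesis .
qed

lemma run:
  assumes "i \<in> {1..n}"
  shows "ssd_run (d i) n d A i (U i)"
proof
  have "dim_col (A i) = d i" using A_carrier[of i] assms by simp
  then show "is_basis_list (module_vec TYPE('a) (d i))
      ((\<lambda>x. A (i - 1) *\<^sub>v x) ` carrier_vec (dim_col (A (i - 1)))) (U i)"
    using img assms unfolding image_basis_choice_def by metis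
qed (use A_carrier assms in auto)

lemma structure_map_T:
  assumes "i \<in> {1..n}" "i \<le> j" "j \<le> n + 1" "x \<in> carrier_vec (d i)"
  shows "structure_map \<phi> i j (T i x) = T j (composite A i (j - i) *\<^sub>v x)"
  using assms(2,3)
proof (induction j rule: dec_induct)
  case base
  then show ?case using assms A_carrier[of i] by simp
next
  case (step j)
  interpret ssd_run "TYPE('a)" "d i" n d A i "U i" using run assms by simp
  have c: "composite A i (j - i) \<in> carrier_mat (d j) (d i)" using P_carrier[of "j - i"] step by simp
  then have "composite A i (j - i) *\<^sub>v x \<in> carrier_vec (d j)" using assms by simp
  moreover have "composite A i (Suc j - i) *\<^sub>v x = A j *\<^sub>v (composite A i (j - i) *\<^sub>v x)"
    using A_carrier[of j] c step assms by (simp add: Suc_diff_le)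
  ultimately show ?case
    using step structure_map_Suc[of i j \<phi>] phi_T[of j] by simp
qed

definition births :: "nat \<Rightarrow> 'a vec set" where
  "births i = set (fst (ssd n A (U i) i))"

text \<open>Injectivity of the coordinate map lets a sum over elements of \<open>M i\<close> be
  pulled back to a sum over coordinate vectors with the same coefficients.\<close>

lemma T_lincomb:
  assumes "i \<in> {1..n}"
  shows "T i (LinearCombinations.module.lincomb (module_vec TYPE('a) (d i)) (\<lambda>v. c (T i v)) (births i)) =
    finsum (M i) (\<lambda>w. c w \<odot>\<^bsub>M i\<^esub> w) (T i ` births i)"
proof -
  interpret S: linear_map class_ring "module_vec TYPE('a) (d i)" "M i" "T i"
    by (rule T_linear) (use assms in simp)
  interpret ssd_run "TYPE('a)" "d i" n d A i "U i" using run assms by simp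
  have B: "births i \<subseteq> carrier_vec (d i)" "finite (births i)"
    using ssd_correct(3) by (auto simp: births_def)
  have "inj_on (T i) (births i)"
    using bij_betw_imp_inj_on[OF T_bij[of i]] B assms inj_on_subset by auto
  then show ?thesis
    using S.lincomb_linear_image[of "births i" c] bij_betw_imp_inj_on[OF T_bij[of i]] B assms
    by (simp add: S.W.module.lincomb_def comp_def class_ring_simps module_vec_simps)
qed

text \<open>Both conditions are carried over from coordinates: \<open>indep\<close> from
  independence of the basis of the image together with the births, \<open>kernel\<close> from
  \<open>kernel_covered\<close> at \<open>s = j - i\<close>.\<close>

lemma generators: "persistence_generators n M \<phi> (\<lambda>i. T i ` births i)"
proof
  fix i assume ir: "i \<in> {1..n}"
  interpret ssd_run "TYPE('a)" "d i" n d A i "U i" using run ir by simp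
  show "finite (T i ` births i) \<and> T i ` births i \<subseteq> carrier (M i)"
    using ssd_correct(3) T_closed[of i] ir by (auto simp: births_def)
next
  fix i u c w
  assume ir: "i \<in> {1..n}" and u: "u \<in> carrier (M (i - 1))" and w: "w \<in> T i ` births i"
    and eq: "\<phi> (i - 1) u \<oplus>\<^bsub>M i\<^esub> finsum (M i) (\<lambda>v. c v \<odot>\<^bsub>M i\<^esub> v) (T i ` births i) = \<zero>\<^bsub>M i\<^esub>"
  interpret ssd_run "TYPE('a)" "d i" n d A i "U i" using run ir by simp
  interpret S: linear_map class_ring V "M i" "T i" by (rule T_linear) (use ir in simp)
  have B: "births i \<subseteq> carrier_vec (d i)" "finite (births i)" "lin_indpt (set (U i) \<union> births i)"
    "set (U i) \<inter> births i = {}"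
    using ssd_correct(1,2,3) by (auto simp: births_def)
  obtain y where y: "y \<in> carrier_vec (d (i - 1))" "u = T (i - 1) y"
    using T_surj[OF _ u] ir by (metis atLeastAtMost_iff diff_le_self le_add1 le_trans)
  let ?l = "lincomb (\<lambda>v. c (T i v)) (births i)"
  have "Suc (i - 1) = i" using ir by simp
  then have phi: "\<phi> (i - 1) u = T i (A (i - 1) *\<^sub>v y)"
    using phi_T[of "i - 1" y] y ir by auto
  have Ay: "A (i - 1) *\<^sub>v y \<in> carrier_vec (d i)" using A_pred y by auto
  have l: "?l \<in> carrier_vec (d i)" using B by simp
  have "T i (A (i - 1) *\<^sub>v y + ?l) = \<zero>\<^bsub>M i\<^esub>"
    using S.f_add[of "A (i - 1) *\<^sub>v y" ?l] Ay l eq phi T_lincomb[OF ir, of c] by simp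
  then have 0: "A (i - 1) *\<^sub>v y + ?l = 0\<^sub>v (d i)"
    using T_eq_zeroD[of i] Ay l ir by simp
  have "A (i - 1) *\<^sub>v y \<in> span (set (U i))"
    using y A_pred unfolding U_basis(4) by auto
  then obtain a where a: "lincomb a (set (U i)) = A (i - 1) *\<^sub>v y"
    using finite_in_span[of "set (U i)" "A (i - 1) *\<^sub>v y"] U_basis(2) by auto
  \<comment> \<open>The list \<open>U i\<close> and the births are disjoint, so the two coefficient
    functions merge into one relation on an independent set.\<close>
  define f where "f = (\<lambda>v. if v \<in> set (U i) then a v else c (T i v))"
  have "lincomb f (set (U i) \<union> births i) = lincomb a (set (U i)) + ?l"
    unfolding f_def using lincomb_union2[of "set (U i)" "births i" a "\<lambda>v. c (T i v)"] B U_basis(2) by simp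
  then have "lincomb f (set (U i) \<union> births i) = 0\<^sub>v (d i)" using 0 a by simp
  then have f0: "f \<in> set (U i) \<union> births i \<rightarrow> {0}"
    using not_lindepD[OF B(3), of "set (U i) \<union> births i" f] B by simp
  obtain v where v: "v \<in> births i" "w = T i v" using w by auto
  then show "c w = 0" using funcset_mem[OF f0, of v] B(4) by (auto simp: f_def split: if_splits)
next
  fix i j x
  assume ir: "i \<in> {1..n}" and j: "i \<le> j" "j \<le> n + 1" and x: "x \<in> carrier (M i)"
    and 0: "structure_map \<phi> i j x = \<zero>\<^bsub>M j\<^esub>"
  interpret ssd_run "TYPE('a)" "d i" n d A i "U i" using run ir by simp
  interpret S: linear_map class_ring V "M i" "T i" by (rule T_linear) (use ir in simp)
  have B: "births i \<subseteq> carrier_vec (d i)" "finite (births i)" "lin_indpt (set (U i) \<union> births i)"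
    "set (U i) \<inter> births i = {}"
    using ssd_correct(1,2,3) by (auto simp: births_def)
  have inj: "inj_on (T i) (carrier_vec (d i))" using bij_betw_imp_inj_on[OF T_bij[of i]] ir by simp
  obtain y where y: "y \<in> carrier_vec (d i)" "x = T i y"
    using T_surj[of i x] x ir by auto
  let ?s = "j - i"
  define B0 where "B0 = {v\<in>births i. P ?s *\<^sub>v v = 0\<^sub>v (d j)}"
  have s: "?s \<le> n - i + 1" "i + ?s = j" using ir j by auto
  then have "P ?s \<in> carrier_mat (d j) (d i)" using P_carrier[of ?s] by simp
  then have "P ?s *\<^sub>v y = 0\<^sub>v (d j)"
    using structure_map_T[OF ir j y(1)] 0 y T_eq_zeroD[OF j(2), of "P ?s *\<^sub>v y"] by simp
  have "y \<in> span (set (U i) \<union> B0)"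
  \<comment> \<open>\<open>ssd_correct\<close> speaks only of \<open>s\<close> from 1 on; for
    \<open>j = i\<close> the composite is the identity, so the vector itself is zero.\<close>
  proof (cases "?s = 0")
    case True
    then have "y = 0\<^sub>v (d i)" using \<open>P ?s *\<^sub>v y = _\<close> y j A_carrier[of i] ir by simp
    then show ?thesis
      using span_is_submodule[of "set (U i) \<union> B0"] B(1) U_basis(2) by (auto simp: submodule_def B0_def)
  next
    case False
    then have "kernel_covered (fst (ssd n A (U i) i)) ?s" using ssd_correct(4)[of ?s] s by auto
    then show ?thesis using y \<open>P ?s *\<^sub>v y = _\<close> j by (simp add: kernel_covered_def births_def B0_def)
  qed
  moreover have B0: "finite B0" "B0 \<subseteq> births i" using B by (auto simp: B0_def)
  ultimately obtain a where a: "lincomb a (set (U i) \<union> B0) = y"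
    using finite_in_span[of "set (U i) \<union> B0" y] U_basis(2) B(1) by auto
  \<comment> \<open>Extension by zero turns a combination of the births dead at \<open>j\<close>
    into one over all births, as \<open>kernel\<close> demands, while recording which coefficients
    can be non-zero.\<close>
  define a' where "a' = (\<lambda>v. if v \<in> B0 then a v else 0)"
  have "lincomb a (set (U i) \<union> B0) = lincomb a (set (U i)) + lincomb a B0"
    using lincomb_union[of "set (U i)" B0 a] B0 B U_basis(2) by auto
  also have "lincomb a B0 = lincomb a' B0"
    using B0 B by (intro lincomb_cong) (auto simp: a'_def)
  also have "\<dots> = lincomb a' (B0 \<union> (births i - B0))"
    by (rule lincomb_clean[symmetric]) (use B0 B in \<open>auto simp: a'_def\<close>)
  also have "B0 \<union> (births i - B0) = births i" using B0 by auto
  finally have yl: "y = lincomb a (set (U i)) + lincomb a' (births i)" using a by simp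
  have "Suc (i - 1) = i" using ir by simp
  have "lincomb a (set (U i)) \<in> span (set (U i))" by auto
  then obtain z where z: "z \<in> carrier_vec (d (i - 1))" "lincomb a (set (U i)) = A (i - 1) *\<^sub>v z"
    using A_pred unfolding U_basis(4) by auto
  \<comment> \<open>Transports the coefficients from coordinate vectors to elements of
    \<open>M i\<close> along the inverse of the coordinate map.\<close>
  define c where "c = (\<lambda>w. a' (the_inv_into (carrier_vec (d i)) (T i) w))"
  have c: "c (T i v) = a' v" if "v \<in> births i" for v
    using that B(1) by (auto simp: c_def the_inv_into_f_f[OF inj])
  have "lincomb (\<lambda>v. c (T i v)) (births i) = lincomb a' (births i)"
    using B c by (intro lincomb_cong) auto
  then have "T i (lincomb a' (births i)) = finsum (M i) (\<lambda>v. c v \<odot>\<^bsub>M i\<^esub> v) (T i ` births i)"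
    using T_lincomb[OF ir, of c] by simp
  moreover have "T i (A (i - 1) *\<^sub>v z) = \<phi> (i - 1) (T (i - 1) z)"
    using phi_T[of "i - 1" z] z ir \<open>Suc (i - 1) = i\<close> by auto
  moreover have "A (i - 1) *\<^sub>v z \<in> carrier_vec (d i)" "lincomb a' (births i) \<in> carrier_vec (d i)"
    using A_pred z B by auto
  ultimately have "x = \<phi> (i - 1) (T (i - 1) z) \<oplus>\<^bsub>M i\<^esub> finsum (M i) (\<lambda>v. c v \<odot>\<^bsub>M i\<^esub> v) (T i ` births i)"
    using S.f_add[of "A (i - 1) *\<^sub>v z" "lincomb a' (births i)"] y(2) yl z(2) by simp
  moreover have "structure_map \<phi> i j w = \<zero>\<^bsub>M j\<^esub>" if w: "w \<in> T i ` births i" "c w \<noteq> 0" for w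
  proof -
    obtain v where v: "v \<in> births i" "w = T i v" using w by auto
    then have "v \<in> B0" using c[OF v(1)] w by (auto simp: a'_def split: if_splits)
    then show ?thesis using structure_map_T[OF ir j, of v] B(1) v T_zero[of j] j by (auto simp: B0_def)
  qed
  moreover have "T (i - 1) z \<in> carrier (M (i - 1))" using T_closed z ir by auto
  ultimately show "\<exists>u\<in>carrier (M (i - 1)). \<exists>c. x = \<phi> (i - 1) u \<oplus>\<^bsub>M i\<^esub>
      finsum (M i) (\<lambda>v. c v \<odot>\<^bsub>M i\<^esub> v) (T i ` births i) \<and>
      (\<forall>v\<in>T i ` births i. c v \<noteq> 0 \<longrightarrow> structure_map \<phi> i j v = \<zero>\<^bsub>M j\<^esub>)"
    by blast
qed

lemma returned_elements_eq: "returned_elements n M bs A U = Sigma {1..n} (\<lambda>i. T i ` births i)"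
  by (force simp: returned_elements_def pm_decomposition_def births_def)

theorem interval_basis_returned_elements: "interval_basis n M \<phi> (returned_elements n M bs A U)"
proof -
  interpret persistence_generators n M \<phi> "\<lambda>i. T i ` births i" by (rule generators)
  show ?thesis using interval_basis_gens by (simp add: gens_def returned_elements_eq)
qed

end

theorem lemma4p7:
  fixes n :: nat
    and M :: "nat \<Rightarrow> ('a::field, 'b) module"
    and \<phi> :: "nat \<Rightarrow> 'b \<Rightarrow> 'b"
    and bs :: "nat \<Rightarrow> 'b list"
    and A :: "nat \<Rightarrow> 'a mat"
    and U :: "nat \<Rightarrow> 'a vec list"
  assumes "persistence_module n M \<phi>"
    and "matrix_presentation n M \<phi> bs A"
    and "image_basis_choice n A U"
  shows "interval_basis n M \<phi> (returned_elements n M bs A U)"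
proof -
  interpret presented_persistence n M \<phi> bs A U
    using assms by unfold_locales
  show ?thesis by (rule interval_basis_returned_elements)
qed

end
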